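(* Let $G=\langle f_1,f_2,\ldots,f_n\rangle\le \mathrm{Homeo}^+(\mathbb{R})$ for some $n\ge2$. (1) Then $G$ embeds (as an abstract group) into an $(n+2)$-chain group. (2) If $\operatorname{supp} f_1$ has finitely many components, then $G$ embeds into an $(n+1)$-chain group.
   Context: $\mathrm{Homeo}^+(\mathbb{R})$ is the group of orientation preserving homeomorphisms of $\mathbb{R}$; $\operatorname{supp} f=\{x: f(x)\ne x\}$. For an interval $J$, $\partial^-J$ is its left endpoint. Chain of intervals: a collection $\{J_1,\ldots,J_m\}$ of nonempty open subintervals of $\mathbb{R}$ (possibly unbounded) such that $J_i\cap J_k=\varnothing$ if $|i-k|>1$, and $J_i\cap J_{i+1}$ is a proper nonempty subinterval of both $J_i$ and $J_{i+1}$ for $1\le i\le m-1$. $m$-chain group ($m\ge 2$): a group $\langle h_1,\ldots,h_m\rangle\le\mathrm{Homeo}^+(\mathbb{R})$ where $\{\operatorname{supp} h_1,\dots,\operatorname{supp} h_m\}$ is a chain of intervals with $\partial^-\operatorname{supp} h_i<\partial^-\operatorname{supp} h_{i+1}$ for all $i<m$, $h_i(t)\ge t$ for all $t$ and $i$, and $\langle h_i,h_{i+1}\rangle\cong F$ for each $1\le i\le m-1$. Here $F=\langle \{g_i\}_{i\ge0}\mid g_i^{-1}g_jg_i=g_{j+1}\text{ for }0\le i<j\rangle$ is Thompson's group. *)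

theory Defs
  imports "HOL-Analysis.Analysis" "HOL-Algebra.Elementary_Groups"
begin

section \<open>Groups given by a presentation\<close>

text \<open>
  A word is a list of letters: \<open>(True, x)\<close> stands for the generator \<open>x\<close> and \<open>(False, x)\<close> for its
  formal inverse. A relation \<open>u = v\<close> is the pair \<open>(u, v)\<close>, and every element of the type \<open>'a\<close> is
  a generator.
\<close>

type_synonym 'a word = "(bool \<times> 'a) list"

inductive word_eq :: "('a word \<times> 'a word) set \<Rightarrow> 'a word \<Rightarrow> 'a word \<Rightarrow> bool"
  for R :: "('a word \<times> 'a word) set"
where
  refl: "word_eq R u u"
| sym: "word_eq R u v \<Longrightarrow> word_eq R v u"
| trans: "word_eq R u v \<Longrightarrow> word_eq R v w \<Longrightarrow> word_eq R u w"
| cancel: "word_eq R (u @ [(b, x), (\<not> b, x)] @ v) (u @ v)"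
| relation: "(l, r) \<in> R \<Longrightarrow> word_eq R (u @ l @ v) (u @ r @ v)"

definition word_rel :: "('a word \<times> 'a word) set \<Rightarrow> ('a word \<times> 'a word) set"
  where "word_rel R = {(u, v). word_eq R u v}"

definition presented_group :: "('a word \<times> 'a word) set \<Rightarrow> 'a word set monoid"
  where "presented_group R =
    \<lparr>carrier = UNIV // word_rel R,
     mult = (\<lambda>A B. \<Union>u\<in>A. \<Union>v\<in>B. word_rel R `` {u @ v}),
     one = word_rel R `` {[]}\<rparr>"

lemma equiv_word_rel: "equiv UNIV (word_rel R)"
  by (rule equivI)
     (auto simp: word_rel_def refl_on_def sym_def trans_def
       intro: word_eq.refl word_eq.sym word_eq.trans)

lemma word_eq_append_left: "word_eq R u v \<Longrightarrow> word_eq R (w @ u) (w @ v)"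
proof (induction rule: word_eq.induct)
  case (cancel u b x v)
  show ?case using word_eq.cancel[of R "w @ u" b x v] by simp
next
  case (relation l r u v)
  then show ?case using word_eq.relation[of l r R "w @ u" v] by simp
qed (blast intro: word_eq.refl word_eq.sym word_eq.trans)+

lemma word_eq_append_right: "word_eq R u v \<Longrightarrow> word_eq R (u @ w) (v @ w)"
proof (induction rule: word_eq.induct)
  case (cancel u b x v)
  show ?case using word_eq.cancel[of R u b x "v @ w"] by simp
next
  case (relation l r u v)
  then show ?case using word_eq.relation[of l r R u "v @ w"] by simp
qed (blast intro: word_eq.refl word_eq.sym word_eq.trans)+

lemma word_eq_append: "word_eq R u u' \<Longrightarrow> word_eq R v v' \<Longrightarrow> word_eq R (u @ v) (u' @ v')"
  by (meson word_eq.trans word_eq_append_left word_eq_append_right)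

lemma congruent2_append:
  "congruent2 (word_rel R) (word_rel R) (\<lambda>u v. word_rel R `` {u @ v})"
proof (rule congruent2I')
  fix u u' v v' assume "(u, u') \<in> word_rel R" "(v, v') \<in> word_rel R"
  then have "(u @ v, u' @ v') \<in> word_rel R"
    by (simp add: word_rel_def word_eq_append)
  then show "word_rel R `` {u @ v} = word_rel R `` {u' @ v'}"
    by (rule equiv_class_eq[OF equiv_word_rel])
qed

lemma mult_presented_group:
  "word_rel R `` {u} \<otimes>\<^bsub>presented_group R\<^esub> word_rel R `` {v} = word_rel R `` {u @ v}"
  by (simp add: presented_group_def
      UN_equiv_class2[OF equiv_word_rel equiv_word_rel congruent2_append])

lemma word_eq_inverse_left: "word_eq R (rev (map (apfst Not) u) @ u) []"
proof (induction u)
  case Nil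
  show ?case by (simp add: word_eq.refl)
next
  case (Cons p u)
  obtain b x where p: "p = (b, x)" by (cases p)
  have "word_eq R (rev (map (apfst Not) u) @ [(\<not> b, x), (\<not> \<not> b, x)] @ u)
      (rev (map (apfst Not) u) @ u)"
    by (rule word_eq.cancel)
  with Cons show ?case by (auto simp: p intro: word_eq.trans)
qed

lemma group_presented_group: "group (presented_group R)"
proof (rule groupI)
  have carr: "A \<in> carrier (presented_group R) \<longleftrightarrow> (\<exists>u. A = word_rel R `` {u})" for A
    by (auto simp: presented_group_def quotient_def)
  have one: "\<one>\<^bsub>presented_group R\<^esub> = word_rel R `` {[]}"
    by (simp add: presented_group_def)
  show "A \<otimes>\<^bsub>presented_group R\<^esub> B \<in> carrier (presented_group R)"
    if "A \<in> carrier (presented_group R)" "B \<in> carrier (presented_group R)" for A B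
    using that by (auto simp: carr mult_presented_group)
  show "\<one>\<^bsub>presented_group R\<^esub> \<in> carrier (presented_group R)"
    by (auto simp: carr one)
  show "A \<otimes>\<^bsub>presented_group R\<^esub> B \<otimes>\<^bsub>presented_group R\<^esub> C =
      A \<otimes>\<^bsub>presented_group R\<^esub> (B \<otimes>\<^bsub>presented_group R\<^esub> C)"
    if "A \<in> carrier (presented_group R)" "B \<in> carrier (presented_group R)"
      "C \<in> carrier (presented_group R)" for A B C
    using that by (auto simp: carr mult_presented_group)
  show "\<one>\<^bsub>presented_group R\<^esub> \<otimes>\<^bsub>presented_group R\<^esub> A = A"
    if "A \<in> carrier (presented_group R)" for A
    using that by (auto simp: carr one mult_presented_group)
  show "\<exists>B\<in>carrier (presented_group R). B \<otimes>\<^bsub>presented_group R\<^esub> A = \<one>\<^bsub>presented_group R\<^esub>"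
    if "A \<in> carrier (presented_group R)" for A
  proof -
    from that obtain u where u: "A = word_rel R `` {u}" by (auto simp: carr)
    let ?B = "word_rel R `` {rev (map (apfst Not) u)}"
    have "(rev (map (apfst Not) u) @ u, []) \<in> word_rel R"
      by (simp add: word_rel_def word_eq_inverse_left)
    then have "?B \<otimes>\<^bsub>presented_group R\<^esub> A = \<one>\<^bsub>presented_group R\<^esub>"
      unfolding u one mult_presented_group by (rule equiv_class_eq[OF equiv_word_rel])
    moreover have "?B \<in> carrier (presented_group R)" by (auto simp: carr)
    ultimately show ?thesis by blast
  qed
qed

definition thompson_F :: "nat word set monoid"
  where "thompson_F = presented_group
    {([(False, i), (True, j), (True, i)], [(True, j + 1)]) | i j. i < j}"


section \<open>Homeomorphisms of the real line\<close>

text \<open>On \<open>\<real>\<close>, a homeomorphism preserves orientation iff it is strictly increasing.\<close>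

definition Homeo_plus :: "(real \<Rightarrow> real) monoid"
  where "Homeo_plus =
    \<lparr>carrier = {f. (\<exists>g. homeomorphism UNIV UNIV f g) \<and> strict_mono f},
     mult = (\<circ>), one = id\<rparr>"

definition homeo_supp :: "(real \<Rightarrow> real) \<Rightarrow> real set"
  where "homeo_supp f = {x. f x \<noteq> x}"

lemma group_Homeo_plus: "group Homeo_plus"
proof (rule groupI)
  show "f \<otimes>\<^bsub>Homeo_plus\<^esub> g \<in> carrier Homeo_plus"
    if "f \<in> carrier Homeo_plus" "g \<in> carrier Homeo_plus" for f g
    using that by (auto simp: Homeo_plus_def strict_mono_def dest: homeomorphism_compose)
  show "\<one>\<^bsub>Homeo_plus\<^esub> \<in> carrier Homeo_plus"
    using homeomorphism_ident[of "UNIV :: real set"]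
    by (auto simp: Homeo_plus_def strict_mono_def id_def)
  show "\<exists>g\<in>carrier Homeo_plus. g \<otimes>\<^bsub>Homeo_plus\<^esub> f = \<one>\<^bsub>Homeo_plus\<^esub>"
    if f: "f \<in> carrier Homeo_plus" for f
  proof -
    from f obtain g where g: "homeomorphism UNIV UNIV f g" and mono: "strict_mono f"
      by (auto simp: Homeo_plus_def)
    have fg: "f (g x) = x" and gf: "g (f x) = x" for x
      using g by (auto simp: homeomorphism_def)
    have "strict_mono g"
      using mono by (metis fg strict_mono_def strict_mono_less)
    then show ?thesis
      using homeomorphism_symD[OF g] gf by (auto simp: Homeo_plus_def fun_eq_iff)
  qed
qed (auto simp: Homeo_plus_def)


section \<open>Chain groups\<close>

text \<open>
  Intersections of intervals are intervals, so ``proper nonempty subinterval'' of \<open>J i \<inter> J (i + 1)\<close>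
  only requires nonemptiness and strict inclusion.
\<close>

definition chain_of_intervals :: "nat \<Rightarrow> (nat \<Rightarrow> real set) \<Rightarrow> bool"
  where "chain_of_intervals m J \<longleftrightarrow>
    (\<forall>i\<in>{1..m}. J i \<noteq> {} \<and> open (J i) \<and> is_interval (J i)) \<and>
    (\<forall>i\<in>{1..m}. \<forall>k\<in>{1..m}. \<bar>int i - int k\<bar> > 1 \<longrightarrow> J i \<inter> J k = {}) \<and>
    (\<forall>i\<in>{1..<m}. J i \<inter> J (i + 1) \<noteq> {} \<and>
      J i \<inter> J (i + 1) \<subset> J i \<and> J i \<inter> J (i + 1) \<subset> J (i + 1))"

text \<open>The left endpoint lives in \<open>ereal\<close>, since it may be \<open>-\<infinity>\<close>.\<close>

definition left_endpoint :: "real set \<Rightarrow> ereal"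
  where "left_endpoint J = (INF x\<in>J. ereal x)"

definition chain_group :: "nat \<Rightarrow> (real \<Rightarrow> real) monoid \<Rightarrow> bool"
  where "chain_group m H \<longleftrightarrow> m \<ge> 2 \<and>
    (\<exists>h. (\<forall>i\<in>{1..m}. h i \<in> carrier Homeo_plus) \<and>
      chain_of_intervals m (\<lambda>i. homeo_supp (h i)) \<and>
      (\<forall>i\<in>{1..<m}. left_endpoint (homeo_supp (h i)) < left_endpoint (homeo_supp (h (i + 1)))) \<and>
      (\<forall>i\<in>{1..m}. \<forall>t. h i t \<ge> t) \<and>
      (\<forall>i\<in>{1..<m}. subgroup_generated Homeo_plus {h i, h (i + 1)} \<cong> thompson_F) \<and>
      H = subgroup_generated Homeo_plus (h ` {1..m}))"

end

theory Submission
  imports Defs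
begin

text \<open>
  Multiplying a bump \<open>s\<close> (a homeomorphism that moves every point of an interval to the right and
  fixes all others) by a homeomorphism \<open>\<phi>\<close> supported in one of its fundamental domains gives a
  conjugate of \<open>s\<close>, say \<open>\<phi> s = \<psi>\<inverse> s \<psi>\<close>. Hence a group that contains \<open>s\<close> and some element acting
  like \<open>\<psi>\<close> on the support of \<open>s\<close> contains \<open>\<phi>\<close>.

  The first two generators of the chain are fixed piecewise linear maps. The group generated by
  them contains a bump \<open>s\<close>, and it compresses every compact part of the union of their supports
  into a fundamental domain of \<open>s\<close>; so the given homeomorphisms, transplanted to a small
  interval, may be taken to be supported there. Each further generator is a fixed model,
  conjugated by a translate of the \<open>\<psi>\<close> that belongs to one of the given homeomorphisms. This
  disturbs neither the supports nor the inequality that makes consecutive generators generate a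
  copy of \<open>F\<close>.

  If the support of \<open>f\<^sub>1\<close> has finitely many components, then \<open>f\<^sub>1\<close> is conjugate to a product of
  bumps with disjoint supports and of their inverses, all in the group of the first two
  generators, and no further generator is needed for it.
\<close>

section \<open>Increasing homeomorphisms of the line\<close>

interpretation Homeo_plus: group Homeo_plus
  by (rule group_Homeo_plus)

text \<open>A monotone map with open image is continuous; this applies to the map and to its
  inverse. Later constructions therefore check only monotonicity and surjectivity.\<close>

lemma Homeo_plus_iff: "f \<in> carrier Homeo_plus \<longleftrightarrow> strict_mono f \<and> surj f"
proof (intro iffI conjI; (elim conjE)?)
  assume "f \<in> carrier Homeo_plus"
  then show "strict_mono f" "surj f"
    by (auto simp: Homeo_plus_def homeomorphism_def)
next
  assume f: "strict_mono f" "surj f"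
  then have inj: "inj f" by (simp add: strict_mono_imp_inj_on)
  have bij: "bij f" using f inj by (simp add: bij_def)
  have "strict_mono (inv_into UNIV f)"
    using f strict_mono_inv_on_range[of f] by (metis strict_monoI strict_mono_less surj_f_inv_f)
  then have "continuous_on UNIV f" "continuous_on UNIV (inv_into UNIV f)"
    using f bij by (auto intro!: continuous_onI_mono
        simp: strict_mono_less_eq bij_imp_bij_inv[THEN bij_is_surj])
  then have "homeomorphism UNIV UNIV f (inv_into UNIV f)"
    using f bij inj by (auto simp: homeomorphism_def surj_f_inv_f bij_imp_bij_inv[THEN bij_is_surj])
  then show "f \<in> carrier Homeo_plus"
    using f by (auto simp: Homeo_plus_def)
qed

lemma mult_Homeo_plus [simp]: "f \<otimes>\<^bsub>Homeo_plus\<^esub> g = f \<circ> g"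
  and one_Homeo_plus [simp]: "\<one>\<^bsub>Homeo_plus\<^esub> = id"
  by (simp_all add: Homeo_plus_def)

lemma homeo_id [simp]: "id \<in> carrier Homeo_plus"
  using Homeo_plus.one_closed by simp

lemma homeo_comp [simp]:
  "f \<in> carrier Homeo_plus \<Longrightarrow> g \<in> carrier Homeo_plus \<Longrightarrow> f \<circ> g \<in> carrier Homeo_plus"
  using Homeo_plus.m_closed[of f g] by simp

abbreviation invf :: "(real \<Rightarrow> real) \<Rightarrow> real \<Rightarrow> real"
  where "invf f \<equiv> inv\<^bsub>Homeo_plus\<^esub> f"

context
  fixes f assumes f: "f \<in> carrier Homeo_plus"
begin

lemma homeo_inv [simp]: "invf f \<in> carrier Homeo_plus"
  using Homeo_plus.inv_closed[OF f] by simp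

lemma homeo_comp_inv [simp]: "f \<circ> invf f = id" "invf f \<circ> f = id"
  using Homeo_plus.r_inv[OF f] Homeo_plus.l_inv[OF f] by auto

lemma homeo_apply_inv [simp]: "f (invf f x) = x"
  and homeo_inv_apply [simp]: "invf f (f x) = x"
  using homeo_comp_inv[THEN fun_cong, of x] by (simp_all only: comp_apply id_apply)

lemma homeo_inv_inv [simp]: "invf (invf f) = f"
  by (rule Homeo_plus.inv_inv[OF f])

lemma homeo_less [simp]: "f x < f y \<longleftrightarrow> x < y"
  and homeo_le [simp]: "f x \<le> f y \<longleftrightarrow> x \<le> y"
  and homeo_eq [simp]: "f x = f y \<longleftrightarrow> x = y"
  using f by (auto simp: Homeo_plus_iff strict_mono_less strict_mono_less_eq strict_mono_eq)

end

context
  fixes f assumes f: "f \<in> carrier Homeo_plus"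
begin

lemma homeo_inv_less: "invf f x < y \<longleftrightarrow> x < f y"
  using homeo_less[OF f, of "invf f x" y] f by simp

lemma homeo_less_inv: "x < invf f y \<longleftrightarrow> f x < y"
  using homeo_less[OF f, of x "invf f y"] f by simp

lemma homeo_inv_le: "invf f x \<le> y \<longleftrightarrow> x \<le> f y"
  using homeo_le[OF f, of "invf f x" y] f by simp

lemma homeo_le_inv: "x \<le> invf f y \<longleftrightarrow> f x \<le> y"
  using homeo_le[OF f, of x "invf f y"] f by simp

lemma homeo_inv_eq: "invf f x = y \<longleftrightarrow> x = f y"
  using homeo_eq[OF f, of "invf f x" y] f by simp

lemma homeo_continuous: "continuous_on S f"
  using f unfolding Homeo_plus_def homeomorphism_def by (auto intro: continuous_on_subset)

lemma homeo_funpow [simp]: "f ^^ k \<in> carrier Homeo_plus"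
proof (induction k)
  case 0
  show ?case using homeo_id by (simp add: id_def)
next
  case (Suc k)
  then show ?case using homeo_comp[OF f, of "f ^^ k"] by (simp add: comp_def)
qed

end

lemma homeo_inv_comp: "f \<in> carrier Homeo_plus \<Longrightarrow> g \<in> carrier Homeo_plus \<Longrightarrow>
    invf (f \<circ> g) = invf g \<circ> invf f"
  using Homeo_plus.inv_mult_group[of f g] by simp

lemma homeo_translation [simp]: "(\<lambda>x. x + a) \<in> carrier Homeo_plus"
  unfolding Homeo_plus_iff by (auto simp: strict_mono_def intro!: surjI[of _ "\<lambda>x. x - a"])

lemma inv_eqI: "g \<circ> f = id \<Longrightarrow> f \<in> carrier Homeo_plus \<Longrightarrow> invf f = g"
  by (metis comp_assoc comp_id homeo_comp_inv(1) id_comp)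

lemma inv_translation [simp]: "invf (\<lambda>x. x + a) = (\<lambda>x. x - a)"
  by (rule inv_eqI) auto

lemma homeo_glue:
  assumes f: "f \<in> carrier Homeo_plus" and g: "g \<in> carrier Homeo_plus" and "f a = g a"
  shows "(\<lambda>x. if x \<le> a then f x else g x) \<in> carrier Homeo_plus" (is "?h \<in> _")
  unfolding Homeo_plus_iff
proof
  have "f x < g y" if "x \<le> a" "a < y" for x y
    using that homeo_le[OF f, of x a] homeo_less[OF g, of a y] assms(3) by linarith
  then show "strict_mono ?h"
    using f g by (intro strict_monoI) (simp add: not_le)
  have "\<exists>x. y = ?h x" for y
  proof (cases "y \<le> f a")
    case True
    then show ?thesis using f by (intro exI[of _ "invf f y"]) (auto simp: homeo_inv_le)
  next
    case False
    then show ?thesis using f g assms(3)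
      by (intro exI[of _ "invf g y"]) (auto simp: homeo_inv_le)
  qed
  then show "surj ?h" unfolding surj_def by blast
qed

text \<open>If \<open>g\<close> moves \<open>x\<close>, then by injectivity it also moves
  \<open>g x\<close>, so \<open>f\<close> fixes both points. The roles of \<open>f\<close> and
  \<open>g\<close> are symmetric.\<close>

lemma homeo_disjoint_commute:
  assumes f: "f \<in> carrier Homeo_plus" and g: "g \<in> carrier Homeo_plus"
    and ffix: "\<And>x. f x = x \<or> g x = x"
  shows "f \<circ> g = g \<circ> f"
proof
  fix x
  show "(f \<circ> g) x = (g \<circ> f) x"
  proof (cases "f x = x")
    case True
    then show ?thesis using ffix[of "g x"] g by (cases "g x = x") auto
  next
    case False
    then have "f (f x) \<noteq> f x" "g x = x" using f ffix[of x] by auto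
    then show ?thesis using ffix[of "f x"] by simp
  qed
qed

text \<open>\<open>invf v \<circ> u\<close> is the identity on the support of \<open>s\<close>,
  hence commutes with \<open>s\<close>. This lets a conjugator be replaced by any element with the
  same values on that support.\<close>

lemma homeo_conj_cong:
  assumes u: "u \<in> carrier Homeo_plus" and v: "v \<in> carrier Homeo_plus"
    and s: "s \<in> carrier Homeo_plus" and eq: "\<And>x. s x \<noteq> x \<Longrightarrow> u x = v x"
  shows "u \<circ> s \<circ> invf u = v \<circ> s \<circ> invf v"
proof -
  have "(invf v \<circ> u) \<circ> s = s \<circ> (invf v \<circ> u)"
    using v eq by (intro homeo_disjoint_commute) (auto simp: u s)
  then have "v \<circ> (invf v \<circ> u) \<circ> s \<circ> invf u = v \<circ> s \<circ> invf v \<circ> (u \<circ> invf u)"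
    by (simp add: o_assoc) (metis comp_assoc)
  moreover have "v \<circ> (invf v \<circ> u) = u" using v by (simp add: fun_eq_iff)
  ultimately show ?thesis using u by simp
qed

lemma subgroup_comp: "subgroup C Homeo_plus \<Longrightarrow> f \<in> C \<Longrightarrow> g \<in> C \<Longrightarrow> f \<circ> g \<in> C"
  using subgroup.m_closed[of C Homeo_plus f g] by simp

lemma subgroup_funpow: "subgroup C Homeo_plus \<Longrightarrow> f \<in> C \<Longrightarrow> f ^^ k \<in> C"
proof (induction k)
  case 0
  then show ?case using subgroup.one_closed[of C Homeo_plus] by (simp add: id_def)
next
  case (Suc k)
  then show ?case using subgroup_comp[of C f "f ^^ k"] by (simp add: o_def)
qed

lemmas subgroup_rules = subgroup_comp subgroup_funpow subgroup.m_inv_closed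

lemma homeo_subgroup:
  assumes "S \<subseteq> carrier Homeo_plus"
  shows homeo_generators: "S \<subseteq> carrier (subgroup_generated Homeo_plus S)"
    and homeo_generated_subgroup: "subgroup (carrier (subgroup_generated Homeo_plus S)) Homeo_plus"
  using assms
  by (auto simp: carrier_subgroup_generated intro: generate.incl Homeo_plus.generate_is_subgroup)

text \<open>A bounded orbit would have a supremum \<open>S\<close> in \<open>(a, b)\<close>, which
  \<open>f\<close> moves to the right. Then some orbit point lies beyond \<open>invf f S\<close>,
  and the next one beyond \<open>S\<close>.\<close>

lemma homeo_dominated_orbit:
  assumes f: "f \<in> carrier Homeo_plus" and pos: "\<And>t. a < t \<Longrightarrow> t < b \<Longrightarrow> t < f t"
    and x: "a < x" "y < b"
  shows "\<exists>k. y < (f ^^ k) x"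
proof (rule ccontr)
  assume "\<nexists>k. y < (f ^^ k) x"
  then have le: "(f ^^ k) x \<le> y" for k by (simp add: not_less)
  define S where "S = (SUP k. (f ^^ k) x)"
  have bdd: "bdd_above (range (\<lambda>k. (f ^^ k) x))" using le by (rule bdd_aboveI2)
  have up: "(f ^^ k) x \<le> S" for k unfolding S_def by (rule cSUP_upper[OF _ bdd]) simp
  have "S \<le> y" unfolding S_def by (rule cSUP_least) (auto intro: le)
  moreover have "x \<le> S" using up[of 0] by simp
  ultimately have "S < f S" using pos[of S] x by linarith
  then have "invf f S < S" using f by (simp add: homeo_inv_less)
  then obtain k where "invf f S < (f ^^ k) x"
    unfolding S_def by (subst (asm) less_cSUP_iff[OF _ bdd]) auto
  then have "S < (f ^^ Suc k) x" using f by (simp add: homeo_inv_less)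
  with up[of "Suc k"] show False by simp
qed

section \<open>Groups isomorphic to a presented group\<close>

definition word_val :: "('g, 'm) monoid_scheme \<Rightarrow> ('a \<Rightarrow> 'g) \<Rightarrow> 'a word \<Rightarrow> 'g"
  where "word_val G \<gamma> u =
    foldr (\<lambda>(b, x) g. (if b then \<gamma> x else inv\<^bsub>G\<^esub> \<gamma> x) \<otimes>\<^bsub>G\<^esub> g) u \<one>\<^bsub>G\<^esub>"

lemma word_val_Nil [simp]: "word_val G \<gamma> [] = \<one>\<^bsub>G\<^esub>"
  and word_val_Cons [simp]: "word_val G \<gamma> ((b, x) # u) =
    (if b then \<gamma> x else inv\<^bsub>G\<^esub> \<gamma> x) \<otimes>\<^bsub>G\<^esub> word_val G \<gamma> u"
  by (simp_all add: word_val_def)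

context group
begin

context
  fixes \<gamma> :: "'x \<Rightarrow> 'a" assumes \<gamma> [simp]: "\<And>x. \<gamma> x \<in> carrier G"
begin

lemma word_val_closed [simp]: "word_val G \<gamma> u \<in> carrier G"
  by (induction u) auto

lemma word_val_append: "word_val G \<gamma> (u @ v) = word_val G \<gamma> u \<otimes> word_val G \<gamma> v"
  by (induction u) (auto simp: m_assoc)

lemma word_val_word_eq:
  assumes "word_eq R u v" and "\<And>l r. (l, r) \<in> R \<Longrightarrow> word_val G \<gamma> l = word_val G \<gamma> r"
  shows "word_val G \<gamma> u = word_val G \<gamma> v"
  using assms(1)
proof induction
  case (cancel u b x v)
  have "word_val G \<gamma> [(b, x), (\<not> b, x)] = \<one>" by simp
  then show ?case by (simp only: word_val_append) simp
next
  case (relation l r u v)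
  then show ?case using assms(2) by (simp add: word_val_append)
qed auto

lemma range_word_val: "range (word_val G \<gamma>) = carrier (subgroup_generated G (range \<gamma>))"
proof
  have sub: "carrier G \<inter> range \<gamma> = range \<gamma>" by auto
  have "word_val G \<gamma> u \<in> generate G (range \<gamma>)" for u
  proof (induction u)
    case (Cons a u)
    obtain b x where "a = (b, x)" by (cases a)
    then show ?case
      using Cons by (auto intro!: generate.eng intro: generate.incl generate.inv)
  qed (simp add: generate.one)
  then show "range (word_val G \<gamma>) \<subseteq> carrier (subgroup_generated G (range \<gamma>))"
    by (auto simp: carrier_subgroup_generated sub)
  show "carrier (subgroup_generated G (range \<gamma>)) \<subseteq> range (word_val G \<gamma>)"
  proof
    fix g assume "g \<in> carrier (subgroup_generated G (range \<gamma>))"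
    then have "g \<in> generate G (range \<gamma>)" by (simp add: carrier_subgroup_generated sub)
    then show "g \<in> range (word_val G \<gamma>)"
    proof induction
      case one
      show ?case by (rule range_eqI[of _ _ "[]"]) simp
    next
      case (incl h)
      then obtain x where "h = \<gamma> x" by auto
      then show ?case by (intro range_eqI[of _ _ "[(True, x)]"]) simp
    next
      case (inv h)
      then obtain x where "h = \<gamma> x" by auto
      then show ?case by (intro range_eqI[of _ _ "[(False, x)]"]) simp
    next
      case (eng g h)
      then obtain u v where "g = word_val G \<gamma> u" "h = word_val G \<gamma> v" by auto
      then show ?case by (intro range_eqI[of _ _ "u @ v"]) (simp add: word_val_append)
    qed
  qed
qed

text \<open>The relations make the evaluation of words well defined on classes, and the second
  hypothesis makes its kernel trivial.\<close>

lemma presented_group_iso: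
  assumes rel: "\<And>l r. (l, r) \<in> R \<Longrightarrow> word_val G \<gamma> l = word_val G \<gamma> r"
    and inj: "\<And>u. word_val G \<gamma> u = \<one> \<Longrightarrow> word_eq R u []"
  shows "presented_group R \<cong> subgroup_generated G (range \<gamma>)"
proof -
  let ?P = "presented_group R" and ?cl = "\<lambda>u. word_rel R `` {u}"
  define \<Phi> where "\<Phi> A = word_val G \<gamma> (SOME u. u \<in> A)" for A
  have carr: "carrier ?P = range ?cl"
    by (auto simp: presented_group_def quotient_def)
  have \<Phi>: "\<Phi> (?cl u) = word_val G \<gamma> u" for u
  proof -
    have "word_eq R u (SOME v. v \<in> ?cl u)"
      using someI[of "\<lambda>v. v \<in> ?cl u" u] by (simp add: word_rel_def word_eq.refl)
    then show ?thesis unfolding \<Phi>_def using word_val_word_eq rel by metis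
  qed
  have hom: "\<Phi> \<in> hom ?P G"
    unfolding hom_def by (auto simp: carr \<Phi> mult_presented_group word_val_append)
  note range = range_word_val
  interpret group_hom ?P G \<Phi>
    by (rule group_hom.intro[OF group_presented_group is_group]) (simp add: group_hom_axioms_def hom)
  have "inj_on \<Phi> (carrier ?P)"
  proof (subst inj_on_one_iff, intro allI impI)
    fix A assume A: "A \<in> carrier ?P" "\<Phi> A = \<one>"
    then obtain u where u: "A = ?cl u" by (auto simp: carr)
    have "word_eq R u []" using A inj \<Phi> u by auto
    then have "?cl u = ?cl []"
      by (intro equiv_class_eq[OF equiv_word_rel]) (simp add: word_rel_def)
    then show "A = \<one>\<^bsub>?P\<^esub>" by (simp add: u presented_group_def)
  qed
  moreover have "\<Phi> ` carrier ?P = carrier (subgroup_generated G (range \<gamma>))"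
    unfolding carr image_image \<Phi> by (rule range)
  ultimately have "\<Phi> \<in> iso ?P (subgroup_generated G (range \<gamma>))"
    using hom by (auto simp: iso_def bij_betw_def hom_def)
  then show ?thesis by (auto simp: is_iso_def)
qed

end

end

section \<open>Thompson's group acting on the line\<close>

abbreviation thompson_rel :: "(nat word \<times> nat word) set"
  where "thompson_rel \<equiv> {([(False, i), (True, j), (True, i)], [(True, j + 1)]) | i j. i < j}"

abbreviation pos_word :: "nat list \<Rightarrow> nat word"
  where "pos_word \<equiv> map (Pair True)"

abbreviation neg_word :: "nat list \<Rightarrow> nat word"
  where "neg_word P \<equiv> rev (map (Pair False) P)"

abbreviation thompson_eq :: "nat word \<Rightarrow> nat word \<Rightarrow> bool"
  where "thompson_eq \<equiv> word_eq thompson_rel"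

section \<open>Normal forms in Thompson's group\<close>

declare word_eq.trans [trans]

lemma word_eq_ctxt: "word_eq R u v \<Longrightarrow> word_eq R (a @ u @ b) (a @ v @ b)"
  by (simp add: word_eq_append_left word_eq_append_right)

lemma thompson_neg_pos:
  assumes "i < j" shows "thompson_eq [(False, i), (True, j)] [(True, j + 1), (False, i)]"
proof -
  have "thompson_eq [(False, i), (True, j)] ([(False, i), (True, j)] @ [(True, i), (\<not> True, i)] @ [])"
    using word_eq.cancel[of _ "[(False, i), (True, j)]" True i "[]"] by (auto intro: word_eq.sym)
  also have "thompson_eq \<dots> [(True, j + 1), (False, i)]"
    using word_eq.relation[of "[(False, i), (True, j), (True, i)]" "[(True, j + 1)]" _ "[]" "[(False, i)]"]
      assms by simp
  finally show ?thesis .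
qed

lemma thompson_pos_pos:
  assumes "i < j" shows "thompson_eq [(True, j), (True, i)] [(True, i), (True, j + 1)]"
proof -
  have "thompson_eq [(True, j), (True, i)] ([] @ [(True, i), (\<not> True, i)] @ [(True, j), (True, i)])"
    using word_eq.cancel[of _ "[]" True i "[(True, j), (True, i)]"] by (auto intro: word_eq.sym)
  also have "thompson_eq \<dots> [(True, i), (True, j + 1)]"
    using word_eq.relation[of "[(False, i), (True, j), (True, i)]" "[(True, j + 1)]" _ "[(True, i)]" "[]"]
      assms by simp
  finally show ?thesis .
qed

lemma thompson_neg_pos':
  assumes "j < i" shows "thompson_eq [(False, i), (True, j)] [(True, j), (False, i + 1)]"
proof -
  have "thompson_eq [(False, i), (True, j)]
      ([(False, i), (True, j)] @ [(True, i + 1), (\<not> True, i + 1)] @ [])"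
    using word_eq.cancel[of _ "[(False, i), (True, j)]" True "i + 1" "[]"] by (auto intro: word_eq.sym)
  also have "thompson_eq \<dots> ([(False, i), (True, i), (True, j), (False, i + 1)])"
    using word_eq_ctxt[OF word_eq.sym[OF thompson_pos_pos[OF assms]], of "[(False, i)]" "[(False, i + 1)]"]
    by simp
  also have "thompson_eq \<dots> [(True, j), (False, i + 1)]"
    using word_eq.cancel[of _ "[]" False i "[(True, j), (False, i + 1)]"] by simp
  finally show ?thesis .
qed

text \<open>The negative letter travels to the right: passing a larger letter it raises that
  letter's index, passing a smaller one it has its own index raised, and an equal one it
  cancels.\<close>

lemma thompson_neg_pos_word:
  "\<exists>P' Q'. thompson_eq ((False, i) # pos_word P) (pos_word P' @ neg_word Q')"
proof (induction P arbitrary: i)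
  case Nil
  show ?case by (intro exI[of _ "[]"] exI[of _ "[i]"]) (simp add: word_eq.refl)
next
  case (Cons j P)
  have *: ?case if "thompson_eq [(False, i), (True, j)] [(True, j'), (False, i')]" for i' j'
  proof -
    obtain P' Q' where PQ: "thompson_eq ((False, i') # pos_word P) (pos_word P' @ neg_word Q')"
      using Cons.IH by blast
    have "thompson_eq ((False, i) # pos_word (j # P)) ([(True, j'), (False, i')] @ pos_word P)"
      using word_eq_append_right[OF that, of "pos_word P"] by simp
    also have "thompson_eq \<dots> ([(True, j')] @ pos_word P' @ neg_word Q')"
      using word_eq_append_left[OF PQ, of "[(True, j')]"] by simp
    finally show ?case by (intro exI[of _ "j' # P'"] exI[of _ Q']) simp
  qed
  consider "i < j" | "j < i" | "i = j" by linarith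
  then show ?case
  proof cases
    case 3
    then have "thompson_eq ((False, i) # pos_word (j # P)) (pos_word P @ neg_word [])"
      using word_eq.cancel[of _ "[]" False i "pos_word P"] by simp
    then show ?thesis by blast
  qed (use * thompson_neg_pos thompson_neg_pos' in blast)+
qed

lemma thompson_fraction: "\<exists>P Q. thompson_eq u (pos_word P @ neg_word Q)"
proof (induction u)
  case Nil
  show ?case by (intro exI[of _ "[]"]) (simp add: word_eq.refl)
next
  case (Cons a u)
  obtain P Q where PQ: "thompson_eq u (pos_word P @ neg_word Q)" using Cons.IH by blast
  then have aPQ: "thompson_eq (a # u) (a # pos_word P @ neg_word Q)"
    using word_eq_append_left[OF PQ, of "[a]"] by simp
  obtain b i where a: "a = (b, i)" by (cases a)
  show ?case
  proof (cases b)
    case True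
    then show ?thesis using aPQ by (intro exI[of _ "i # P"] exI[of _ Q]) (simp add: a)
  next
    case False
    obtain P' Q' where PQ': "thompson_eq ((False, i) # pos_word P) (pos_word P' @ neg_word Q')"
      using thompson_neg_pos_word by blast
    note aPQ
    also have "thompson_eq (a # pos_word P @ neg_word Q) (pos_word P' @ neg_word (Q @ Q'))"
      using word_eq_append_right[OF PQ', of "neg_word Q"] False by (simp add: a)
    finally show ?thesis by blast
  qed
qed

lemma thompson_move_left:
  "(\<forall>x\<in>set P. i < x) \<Longrightarrow> thompson_eq (pos_word (P @ [i])) (pos_word (i # map Suc P))"
proof (induction P)
  case Nil
  show ?case by (simp add: word_eq.refl)
next
  case (Cons j P)
  have "thompson_eq (pos_word ((j # P) @ [i])) ([(True, j), (True, i)] @ pos_word (map Suc P))"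
    using word_eq_append_left[OF Cons.IH, of "[(True, j)]"] Cons.prems by simp
  also have "thompson_eq \<dots> (pos_word (i # map Suc (j # P)))"
    using word_eq_append_right[OF thompson_pos_pos[of i j], of "pos_word (map Suc P)"] Cons.prems
    by simp
  finally show ?case .
qed

text \<open>Insertion sort: the last letter moves left past the block \<open>B\<close> of larger
  letters. Their indices go up by one, so the list stays sorted.\<close>

lemma thompson_sort: "\<exists>P'. sorted P' \<and> thompson_eq (pos_word P) (pos_word P')"
proof (induction P rule: rev_induct)
  case Nil
  show ?case by (intro exI[of _ "[]"]) (simp add: word_eq.refl)
next
  case (snoc i P)
  then obtain P' where P': "sorted P'" "thompson_eq (pos_word P) (pos_word P')" by blast
  define A B where "A = filter (\<lambda>x. x \<le> i) P'" and "B = filter (\<lambda>x. i < x) P'"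
  have split: "P' = A @ B"
    using P'(1) unfolding A_def B_def
  proof (induction P')
    case (Cons a P')
    show ?case
    proof (cases "a \<le> i")
      case False
      then have "\<forall>x\<in>set (a # P'). i < x" using Cons.prems by auto
      then have "filter (\<lambda>x. x \<le> i) (a # P') = []" "filter (\<lambda>x. i < x) (a # P') = a # P'"
        by (auto simp: filter_empty_conv filter_id_conv)
      then show ?thesis by simp
    qed (use Cons in auto)
  qed simp
  have "thompson_eq (pos_word (P @ [i])) (pos_word A @ pos_word (B @ [i]))"
    using word_eq_append_right[OF P'(2), of "[(True, i)]"] split by simp
  also have "thompson_eq \<dots> (pos_word A @ pos_word (i # map Suc B))"
    by (intro word_eq_append_left thompson_move_left) (simp add: B_def)
  finally have "thompson_eq (pos_word (P @ [i])) (pos_word (A @ i # map Suc B))" by simp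
  moreover have "sorted (A @ i # map Suc B)"
    using P'(1) by (auto simp: A_def B_def sorted_append sorted_map intro: sorted_filter
        sorted_wrt_mono_rel sorted_wrt_filter)
  ultimately show ?case by blast
qed

lemma word_eq_pos_neg: "word_eq R (pos_word P @ neg_word P) []"
proof (induction P)
  case Nil
  show ?case by (simp add: word_eq.refl)
next
  case (Cons i P)
  have "word_eq R (pos_word (i # P) @ neg_word (i # P)) ([(True, i)] @ [] @ [(False, i)])"
    using word_eq_ctxt[OF Cons, of "[(True, i)]" "[(False, i)]"] by simp
  also have "word_eq R \<dots> []"
    using word_eq.cancel[of R "[]" True i "[]"] by simp
  finally show ?case .
qed

section \<open>Faithful actions of Thompson's group\<close>

text \<open>
  The displacement hypotheses are satisfied by taking \<open>x i\<close> close to the left endpoint of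
  the support of \<open>\<gamma> i\<close> when these endpoints increase with \<open>i\<close>.
\<close>

lemma thompson_pos_word_unique:
  assumes \<gamma>: "\<And>i. \<gamma> i \<in> carrier Homeo_plus"
    and neg: "\<And>i t. \<gamma> i t \<le> t"
    and move: "\<And>i. \<gamma> i (x i) < x i"
    and fixed: "\<And>i j. i < j \<Longrightarrow> \<gamma> j (x i) = x i"
    and "sorted P" "sorted Q"
    and "word_val Homeo_plus \<gamma> (pos_word P) = word_val Homeo_plus \<gamma> (pos_word Q)"
  shows "P = Q"
proof -
  let ?v = "\<lambda>P. word_val Homeo_plus \<gamma> (pos_word P)"
  have le: "?v P t \<le> t" for P t
    by (induction P) (auto intro: order_trans[OF neg])
  have stays: "(\<forall>j\<in>set P. i < j) \<Longrightarrow> ?v P (x i) = x i" for P i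
    by (induction P) (auto simp: fixed)
  have moves: "?v (i # P) (x i) < x i" for P i
  proof -
    have "\<gamma> i (?v P (x i)) \<le> \<gamma> i (x i)" using \<gamma> le by simp
    with move[of i] show ?thesis by simp
  qed
  \<comment> \<open>A word that begins with \<open>i\<close> pulls \<open>x i\<close> to the left,
    whereas a word in larger letters fixes it. Hence sorted words with equal values begin with the
    same letter, which can then be cancelled.\<close>
  have neq: False if "?v (i # P) = ?v Q" "\<forall>j\<in>set Q. i < j" for i P Q
    using moves[of i P] stays[of Q i] that by (metis less_irrefl)
  show ?thesis
    using assms(5-)
  proof (induction P arbitrary: Q)
    case Nil
    show ?case
    proof (cases Q)
      case (Cons j Q')
      have False by (rule neq[of j Q' "[]"]) (simp_all only: Nil.prems(3) Cons[symmetric], simp)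
      then show ?thesis ..
    qed simp
  next
    case (Cons i P)
    show ?case
    proof (cases Q)
      case Nil
      have False by (rule neq[of i P "[]"]) (simp_all only: Cons.prems(3) Nil, simp)
      then show ?thesis ..
    next
      case [simp]: (Cons j Q')
      have "i = j"
      proof (rule linorder_cases[of i j])
        assume "i < j"
        then have "\<forall>j\<in>set Q. i < j" using Cons.prems(2) by auto
        then show ?thesis using neq[OF Cons.prems(3)] by simp
      next
        assume "j < i"
        then have "\<forall>j'\<in>set (i # P). j < j'" using Cons.prems(1) by auto
        then show ?thesis using neq[OF Cons.prems(3)[unfolded Cons, symmetric]] by simp
      qed
      moreover have "?v P = ?v Q'"
      proof
        fix t show "?v P t = ?v Q' t"
          using fun_cong[OF Cons.prems(3), of t] \<gamma> \<open>i = j\<close> by simp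
      qed
      ultimately show ?thesis using Cons.IH[of Q'] Cons.prems by simp
    qed
  qed
qed

text \<open>Every word is a fraction of two sorted positive words. If its value is trivial,
  numerator and denominator have the same value, so they are the same word and the fraction is
  trivial in \<open>F\<close>.\<close>

lemma homeo_group_iso_thompson:
  assumes \<gamma>: "\<And>i. \<gamma> i \<in> carrier Homeo_plus"
    and neg: "\<And>i t. \<gamma> i t \<le> t"
    and move: "\<And>i. \<gamma> i (x i) < x i"
    and fixed: "\<And>i j. i < j \<Longrightarrow> \<gamma> j (x i) = x i"
    and rel: "\<And>i j. i < j \<Longrightarrow> invf (\<gamma> i) \<circ> \<gamma> j \<circ> \<gamma> i = \<gamma> (Suc j)"
  shows "subgroup_generated Homeo_plus (range \<gamma>) \<cong> thompson_F"
proof -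
  let ?v = "word_val Homeo_plus \<gamma>"
  have val_rel: "?v l = ?v r" if "(l, r) \<in> thompson_rel" for l r
    using that rel by (auto simp: o_def)
  have "thompson_eq u []" if u: "?v u = id" for u
  proof -
    obtain P Q where PQ: "thompson_eq u (pos_word P @ neg_word Q)"
      using thompson_fraction by blast
    obtain P' Q' where P': "sorted P'" "thompson_eq (pos_word P) (pos_word P')"
      and Q': "sorted Q'" "thompson_eq (pos_word Q) (pos_word Q')"
      using thompson_sort[of P] thompson_sort[of Q] by auto
    have val: "?v w = ?v w'" if "thompson_eq w w'" for w w'
      by (rule Homeo_plus.word_val_word_eq[OF \<gamma> that val_rel])
    have "?v (pos_word Q) = ?v u \<circ> ?v (pos_word Q)" using u by simp
    also have "\<dots> = ?v (pos_word P @ neg_word Q) \<circ> ?v (pos_word Q)" using val[OF PQ] by simp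
    also have "\<dots> = ?v (pos_word P) \<circ> ?v (neg_word Q @ pos_word Q)"
      by (simp add: Homeo_plus.word_val_append[OF \<gamma>] o_assoc)
    also have "?v (neg_word Q @ pos_word Q) = ?v []"
      using word_eq_inverse_left[of thompson_rel "pos_word Q"] by (intro val) (simp add: o_def)
    finally have PQ': "?v (pos_word P') = ?v (pos_word Q')"
      using val[OF P'(2)] val[OF Q'(2)] by simp
    have "P' = Q'"
      by (rule thompson_pos_word_unique[of \<gamma> x, OF \<gamma> neg move fixed P'(1) Q'(1) PQ'])
    then have "thompson_eq (pos_word P) (pos_word Q)"
      using word_eq.trans[OF P'(2)] word_eq.sym[OF Q'(2)] by simp
    note PQ
    also have "thompson_eq (pos_word P @ neg_word Q) (pos_word Q @ neg_word Q)"
      by (rule word_eq_append_right) fact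
    also have "thompson_eq \<dots> []" by (rule word_eq_pos_neg)
    finally show ?thesis .
  qed
  then have "thompson_F \<cong> subgroup_generated Homeo_plus (range \<gamma>)"
    unfolding thompson_F_def using \<gamma> val_rel by (intro Homeo_plus.presented_group_iso) auto
  then show ?thesis
    using group.iso_sym[OF group_presented_group] by (auto simp: thompson_F_def)
qed

text \<open>
  With \<open>k = g \<circ> f\<close> the elements \<open>k\<inverse>\<close>, \<open>g\<inverse>\<close>, \<open>k g\<inverse> k\<inverse>\<close>, \<open>k\<^sup>2 g\<inverse> k\<^sup>-\<^sup>2\<close>, \<dots> satisfy the
  relations of \<open>F\<close>: the only nontrivial point is that \<open>f\<close> commutes with all of them but the
  first two, because their supports lie to the right of \<open>k b \<ge> c\<close>.
\<close>

lemma chain_pair_iso_thompson: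
  assumes f: "f \<in> carrier Homeo_plus" and g: "g \<in> carrier Homeo_plus"
    and fpos: "\<And>t. t \<le> f t" and gpos: "\<And>t. t \<le> g t"
    and ffix: "\<And>t. c \<le> t \<Longrightarrow> f t = t" and gfix: "\<And>t. t \<le> b \<Longrightarrow> g t = t"
    and bc: "b < c" "c < g c" "c \<le> g (f b)"
  shows "subgroup_generated Homeo_plus {f, g} \<cong> thompson_F"
proof -
  define k where "k = g \<circ> f"
  have k [simp]: "k \<in> carrier Homeo_plus" using f g by (simp add: k_def)
  note [simp] = f g
  have kpos: "t \<le> k t" for t using fpos[of t] gpos[of "f t"] by (simp add: k_def)
  define \<gamma> where "\<gamma> i = (case i of 0 \<Rightarrow> invf k | Suc l \<Rightarrow> k ^^ l \<circ> invf g \<circ> invf (k ^^ l))" for i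
  have \<gamma>0: "\<gamma> 0 = invf k" and \<gamma>1: "\<gamma> (Suc 0) = invf g"
    and \<gamma>S: "\<gamma> (Suc l) = k ^^ l \<circ> invf g \<circ> invf (k ^^ l)" for l
    using Homeo_plus.inv_one by (simp_all add: \<gamma>_def id_def[symmetric])
  have \<gamma> [simp]: "\<gamma> i \<in> carrier Homeo_plus" for i
    by (cases i) (simp_all add: \<gamma>0 \<gamma>S)
  have shift: "k \<circ> \<gamma> (Suc l) \<circ> invf k = \<gamma> (Suc (Suc l))" for l
    by (simp add: \<gamma>S homeo_inv_comp o_assoc)
  have neg: "\<gamma> i t \<le> t" for i t
  proof (cases i)
    case 0
    then show ?thesis using kpos by (simp add: \<gamma>0 homeo_inv_le)
  next
    case (Suc l)
    have "invf g (invf (k ^^ l) t) \<le> invf (k ^^ l) t" using gpos by (simp add: homeo_inv_le)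
    then show ?thesis using Suc by (simp add: \<gamma>S homeo_le_inv)
  qed
  have b_fixed: "\<gamma> (Suc l) t = t" if "t \<le> (k ^^ l) b" for l t
  proof -
    have "invf (k ^^ l) t \<le> b" using that by (simp add: homeo_inv_le)
    then have "invf g (invf (k ^^ l) t) = invf (k ^^ l) t" using gfix by (simp add: homeo_inv_eq)
    then show ?thesis by (simp add: \<gamma>S)
  qed
  have kb: "(k ^^ l) b \<le> (k ^^ (l + m)) b" for l m
    by (induction m) (use kpos order_trans in \<open>auto\<close>)
  have kb1: "c \<le> k b" using bc by (simp add: k_def)
  have commute: "f \<circ> \<gamma> (Suc (Suc l)) = \<gamma> (Suc (Suc l)) \<circ> f" for l
  proof (rule homeo_disjoint_commute)
    fix t
    have "c \<le> (k ^^ 1) b" using kb1 by simp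
    also have "\<dots> \<le> (k ^^ (1 + l)) b" by (rule kb)
    finally show "f t = t \<or> \<gamma> (Suc (Suc l)) t = t"
      using ffix[of t] b_fixed[of t "Suc l"] by (cases "c \<le> t") auto
  qed simp_all
  \<comment> \<open>On these elements conjugation by \<open>g\<close> agrees with conjugation by
    \<open>k\<close>, because \<open>f\<close> commutes with them.\<close>
  have gk: "g \<circ> \<gamma> (Suc (Suc l)) \<circ> invf g = \<gamma> (Suc (Suc (Suc l)))" for l
  proof -
    have "\<gamma> (Suc (Suc (Suc l))) = g \<circ> (f \<circ> \<gamma> (Suc (Suc l))) \<circ> invf f \<circ> invf g"
      by (simp add: shift[symmetric] k_def homeo_inv_comp o_assoc)
    also have "\<dots> = g \<circ> \<gamma> (Suc (Suc l)) \<circ> (f \<circ> invf f) \<circ> invf g"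
      by (simp only: commute o_assoc)
    finally show ?thesis by simp
  qed
  \<comment> \<open>Conjugation by \<open>k\<close> raises both indices by one, which reduces the
    claim to \<open>i = 0\<close>.\<close>
  have rel_pos: "invf (\<gamma> (Suc i)) \<circ> \<gamma> (Suc j) \<circ> \<gamma> (Suc i) = \<gamma> (Suc (Suc j))" if "i < j" for i j
    using that
  proof (induction i arbitrary: j)
    case 0
    then obtain l where "j = Suc l" by (cases j) auto
    then show ?case using gk[of l] by (simp add: \<gamma>1 o_def)
  next
    case (Suc i)
    then obtain l where l: "j = Suc l" "i < l" by (cases j) auto
    have "invf (\<gamma> (Suc (Suc i))) \<circ> \<gamma> (Suc j) \<circ> \<gamma> (Suc (Suc i))
        = k \<circ> (invf (\<gamma> (Suc i)) \<circ> (invf k \<circ> k) \<circ> \<gamma> (Suc l) \<circ> (invf k \<circ> k) \<circ> \<gamma> (Suc i)) \<circ> invf k"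
      unfolding shift[symmetric] l(1) by (simp only: homeo_inv_comp homeo_comp homeo_inv k \<gamma> homeo_inv_inv o_assoc)
    also have "\<dots> = k \<circ> \<gamma> (Suc (Suc l)) \<circ> invf k" by (simp only: homeo_comp_inv(2)[OF k] comp_id Suc.IH[OF l(2)])
    finally show ?case by (simp only: shift l(1))
  qed
  have rel: "invf (\<gamma> i) \<circ> \<gamma> j \<circ> \<gamma> i = \<gamma> (Suc j)" if "i < j" for i j
  proof (cases i)
    case 0
    then obtain l where "j = Suc l" using \<open>i < j\<close> by (cases j) auto
    then show ?thesis using 0 shift[of l] by (simp add: \<gamma>0)
  next
    case (Suc i')
    then obtain l where "j = Suc l" using \<open>i < j\<close> by (cases j) auto
    then show ?thesis using Suc that rel_pos[of i' l] by simp
  qed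
  \<comment> \<open>Here \<open>k\<close> moves \<open>b\<close> and \<open>g\<close> moves
    \<open>c\<close>. Since \<open>c \<le> k b\<close>, each \<open>x i\<close> lies in the region
    \<open>t \<le> (k ^^ l) b\<close> that \<open>\<gamma> (Suc l)\<close> fixes when
    \<open>i \<le> l\<close>.\<close>
  define x where "x i = (case i of 0 \<Rightarrow> b | Suc l \<Rightarrow> (k ^^ l) c)" for i
  have move: "\<gamma> i (x i) < x i" for i
  proof (cases i)
    case 0
    then show ?thesis using kb1 bc by (simp add: \<gamma>0 x_def homeo_inv_less)
  next
    case (Suc l)
    then show ?thesis using bc by (simp add: \<gamma>S x_def homeo_inv_less)
  qed
  have fixed: "\<gamma> j (x i) = x i" if "i < j" for i j
  proof -
    obtain l where l: "j = Suc l" using \<open>i < j\<close> by (cases j) auto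
    have "x i \<le> (k ^^ l) b"
    proof (cases i)
      case 0
      then show ?thesis using kb[of 0 l] by (simp add: x_def)
    next
      case (Suc i')
      then have "l = Suc i' + (l - Suc i')" using \<open>i < j\<close> l by simp
      then obtain m where m: "l = Suc i' + m" by blast
      have "(k ^^ i') c \<le> (k ^^ i') (k b)" using kb1 by simp
      also have "\<dots> = (k ^^ Suc i') b" by (simp add: funpow_swap1)
      also have "\<dots> \<le> (k ^^ l) b" using kb[of "Suc i'" m] by (simp add: m)
      finally show ?thesis by (simp add: x_def Suc)
    qed
    then show ?thesis using b_fixed l by simp
  qed
  have "carrier (subgroup_generated Homeo_plus (range \<gamma>)) = carrier (subgroup_generated Homeo_plus {f, g})"
    (is "?A = ?B")
  proof
    have A: "range \<gamma> \<subseteq> ?A" "subgroup ?A Homeo_plus"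
      using \<gamma> by (intro homeo_subgroup; auto)+
    have B: "{f, g} \<subseteq> ?B" "subgroup ?B Homeo_plus"
      by (intro homeo_subgroup; simp)+
    note memA = subgroup.m_closed[OF A(2), simplified] subgroup.m_inv_closed[OF A(2)]
    note memB = subgroup.m_closed[OF B(2), simplified] subgroup.m_inv_closed[OF B(2)]
    have kB: "k \<in> ?B" using B memB by (simp add: k_def)
    have klB: "k ^^ l \<in> ?B" for l
    proof (induction l)
      case 0
      show ?case using subgroup.one_closed[OF B(2)] by (simp add: id_def)
    next
      case (Suc l)
      then show ?case using memB(1)[OF kB] by (simp add: o_def)
    qed
    have "\<gamma> i \<in> ?B" for i
    proof (cases i)
      case 0
      then show ?thesis using kB memB by (simp add: \<gamma>0)
    next
      case (Suc l)
      then show ?thesis using klB[of l] B memB by (simp add: \<gamma>S)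
    qed
    then show "?A \<subseteq> ?B"
      using B(2) by (intro Homeo_plus.subgroup_generated_minimal) auto
    have g\<gamma>: "g = invf (\<gamma> 1)" by (simp add: \<gamma>1)
    have "f = \<gamma> 1 \<circ> invf (\<gamma> 0)" by (simp add: \<gamma>0 \<gamma>1 k_def o_assoc)
    moreover have "\<gamma> 0 \<in> ?A" "\<gamma> 1 \<in> ?A" using A by auto
    ultimately have "f \<in> ?A" "g \<in> ?A" using memA g\<gamma> by metis+
    then show "?B \<subseteq> ?A"
      using A(2) by (intro Homeo_plus.subgroup_generated_minimal) auto
  qed
  then have "subgroup_generated Homeo_plus (range \<gamma>) = subgroup_generated Homeo_plus {f, g}"
    by (simp add: subgroup_generated_def)
  then show ?thesis
    using homeo_group_iso_thompson[of \<gamma> x] neg move fixed rel by simp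
qed

section \<open>Homeomorphisms of intervals\<close>

text \<open>The two charts are matched parameter by parameter, and translations continue the map to
  the whole line. If the intervals coincide, the continuation is the identity outside.\<close>

lemma interval_homeo:
  fixes a b c d :: real and E E' :: "'t::linorder \<Rightarrow> real"
  assumes E: "strict_mono E" "range E = {a<..<b}" and E': "strict_mono E'" "range E' = {c<..<d}"
  shows "\<exists>\<theta>\<in>carrier Homeo_plus. (\<forall>t. \<theta> (E t) = E' t) \<and>
    (\<forall>x\<le>a. \<theta> x = x - a + c) \<and> (\<forall>x\<ge>b. \<theta> x = x - b + d)"
proof -
  define G where "G = inv_into UNIV E"
  have GE: "G (E t) = t" for t
    using E(1) by (simp add: G_def strict_mono_imp_inj_on)
  have mid: "\<exists>t. x = E t" if "a < x" "x < b" for x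
  proof -
    have "x \<in> range E" unfolding E(2) using that by simp
    then show ?thesis by blast
  qed
  have bE: "a < E t" "E t < b" "c < E' t" "E' t < d" for t
    using E(2) E'(2) by (metis greaterThanLessThan_iff rangeI)+
  \<comment> \<open>Any parameter shows that both intervals are nonempty.\<close>
  have cd: "c < d" "a < b" using bE[of undefined] by linarith+
  define \<theta> where "\<theta> x = (if x \<le> a then x - a + c else if b \<le> x then x - b + d else E' (G x))" for x
  have \<theta>E: "\<theta> (E t) = E' t" for t
    using bE[of t] by (simp add: \<theta>_def GE)
  have low: "\<theta> x = x - a + c" if "x \<le> a" for x using that by (simp add: \<theta>_def)
  have high: "\<theta> x = x - b + d" if "b \<le> x" for x using that cd by (simp add: \<theta>_def)
  have trich: "x \<le> a \<or> b \<le> x \<or> (\<exists>t. x = E t)" for x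
    using mid[of x] by (meson not_le)
  have "strict_mono \<theta>"
  proof (rule strict_monoI)
    fix x y :: real assume xy: "x < y"
    consider "x \<le> a" | t where "x = E t" | "b \<le> x" using trich[of x] by blast
    then show "\<theta> x < \<theta> y"
    proof cases
      case 1
      consider "y \<le> a" | t where "y = E t" | "b \<le> y" using trich[of y] by blast
      then show ?thesis
      proof cases
        case 2
        then show ?thesis using \<open>x \<le> a\<close> low[of x] bE[of t] by (simp add: \<theta>E)
      qed (use 1 low high xy cd in auto)
    next
      case t: (2 t)
      consider "y \<le> a" | t where "y = E t" | "b \<le> y" using trich[of y] by blast
      then show ?thesis
      proof cases
        case 1
        then show ?thesis using t bE[of t] xy by simp
      next
        case (2 s)
        then show ?thesis using t xy E(1) E'(1) by (simp add: \<theta>E strict_mono_less)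
      next
        case 3
        then show ?thesis using t bE[of t] high[of y] by (simp add: \<theta>E)
      qed
    next
      case 3
      then show ?thesis using xy by (simp add: high)
    qed
  qed
  moreover have "\<exists>x. y = \<theta> x" for y
  proof -
    consider "y \<le> c" | "c < y" "y < d" | "d \<le> y" by linarith
    then show ?thesis
    proof cases
      case 1
      then show ?thesis using low[of "y - c + a"] by (intro exI[of _ "y - c + a"]) simp
    next
      case 2
      then have "y \<in> range E'" using E' by simp
      then obtain t where "y = E' t" by blast
      then show ?thesis using \<theta>E by (intro exI[of _ "E t"]) simp
    next
      case 3
      then show ?thesis using high[of "y - d + b"] by (intro exI[of _ "y - d + b"]) simp
    qed
  qed
  then have "surj \<theta>" unfolding surj_def by blast
  ultimately show ?thesis using \<theta>E low high by (intro bexI[of _ \<theta>]) (auto simp: Homeo_plus_iff)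
qed

text \<open>For a chart \<open>E\<close> of a bounded interval this is an injective homomorphism
  into the homeomorphisms supported there. It provides the final embedding.\<close>

definition transplant :: "(real \<Rightarrow> real) \<Rightarrow> (real \<Rightarrow> real) \<Rightarrow> real \<Rightarrow> real"
  where "transplant E f x = (if x \<in> range E then E (f (inv_into UNIV E x)) else x)"

lemma transplant_outside: "x \<notin> range E \<Longrightarrow> transplant E f x = x"
  by (simp add: transplant_def)

lemma transplant_apply: "strict_mono E \<Longrightarrow> transplant E f (E t) = E (f t)"
  by (simp add: transplant_def strict_mono_imp_inj_on)

lemma transplant_eqI:
  assumes "strict_mono E" "\<And>t. g (E t) = E (f t)" "\<And>x. x \<notin> range E \<Longrightarrow> g x = x"
  shows "transplant E f = g"
proof
  fix x show "transplant E f x = g x"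
    using assms by (cases "x \<in> range E") (auto simp: transplant_apply transplant_outside)
qed

text \<open>\<open>E\<close> and \<open>E \<circ> f\<close> are charts of the same interval, and the
  map that matches them is the transplant of \<open>f\<close>.\<close>

lemma homeo_transplant:
  assumes E: "strict_mono E" "range E = {a<..<b}" and f: "f \<in> carrier Homeo_plus"
  shows "transplant E f \<in> carrier Homeo_plus"
proof -
  have f': "strict_mono f" "surj f" using f by (auto simp: Homeo_plus_iff)
  have mono: "strict_mono (E \<circ> f)" using E(1) f'(1) by (simp add: strict_mono_def)
  have range: "range (E \<circ> f) = {a<..<b}" using f'(2) E(2) by (metis image_comp)
  obtain \<theta> where \<theta>: "\<theta> \<in> carrier Homeo_plus" "\<forall>t. \<theta> (E t) = (E \<circ> f) t"
    "\<forall>x\<le>a. \<theta> x = x - a + a" "\<forall>x\<ge>b. \<theta> x = x - b + b"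
    using interval_homeo[OF E mono range] by blast
  have "transplant E f = \<theta>"
    using E(1) \<theta> by (intro transplant_eqI) (auto simp: E(2) not_less)
  with \<theta>(1) show ?thesis by simp
qed

lemma transplant_comp:
  assumes "strict_mono E"
  shows "transplant E (f \<circ> g) = transplant E f \<circ> transplant E g"
  using assms by (intro transplant_eqI) (auto simp: transplant_apply transplant_outside)

lemma inj_transplant: "strict_mono E \<Longrightarrow> inj (transplant E)"
proof (rule injI, rule ext)
  fix f g t assume E: "strict_mono E" and "transplant E f = transplant E g"
  then have "E (f t) = E (g t)" by (metis transplant_apply)
  then show "f t = g t" using E by (simp add: strict_mono_eq)
qed

lemma unit_interval_chart: "\<exists>E::real \<Rightarrow> real. strict_mono E \<and> range E = {0<..<1}"
proof (intro exI conjI)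
  let ?E = "\<lambda>t. (arctan t + pi / 2) / pi"
  show "strict_mono ?E" by (auto simp: strict_mono_def divide_strict_right_mono arctan_less_iff)
  show "range ?E = {0<..<1}"
  proof (intro equalityI subsetI)
    fix y :: real assume "y \<in> {0<..<1}"
    then have "0 < pi * y" "pi * y < pi" by auto
    then have "arctan (tan (pi * y - pi / 2)) = pi * y - pi / 2"
      by (intro arctan_tan) linarith+
    then show "y \<in> range ?E" by (intro range_eqI[of _ _ "tan (pi * y - pi / 2)"]) simp
  next
    fix y assume "y \<in> range ?E"
    then obtain t where t: "y = ?E t" by blast
    have "0 < arctan t + pi / 2" "arctan t + pi / 2 < pi" using arctan_bounded[of t] by auto
    then show "y \<in> {0<..<1}" by (simp add: t)
  qed
qed

section \<open>Homeomorphisms without fixed points on an interval\<close>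

text \<open>The behaviour outside \<open>[a, b]\<close> is left open, so that a homeomorphism can be
  treated on one component of its support at a time.\<close>

definition pushes :: "real \<Rightarrow> real \<Rightarrow> (real \<Rightarrow> real) \<Rightarrow> bool"
  where "pushes a b f \<longleftrightarrow> f \<in> carrier Homeo_plus \<and> a < b \<and> f a = a \<and> f b = b \<and>
    (\<forall>x. a < x \<and> x < b \<longrightarrow> x < f x)"

definition bump :: "real \<Rightarrow> real \<Rightarrow> (real \<Rightarrow> real) \<Rightarrow> bool"
  where "bump a b f \<longleftrightarrow> pushes a b f \<and> (\<forall>x. x \<le> a \<or> b \<le> x \<longrightarrow> f x = x)"

lemma bump_conj:
  assumes f: "bump a b f" and u: "u \<in> carrier Homeo_plus"
  shows "bump (u a) (u b) (u \<circ> f \<circ> invf u)"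
proof -
  have "(u \<circ> f \<circ> invf u) x = x" if "x \<le> u a \<or> u b \<le> x" for x
  proof -
    have "invf u x \<le> a \<or> b \<le> invf u x" using that u by (simp add: homeo_inv_le homeo_le_inv)
    then have "f (invf u x) = invf u x" using f by (auto simp: bump_def)
    then show ?thesis using u by simp
  qed
  moreover have "x < (u \<circ> f \<circ> invf u) x" if "u a < x" "x < u b" for x
  proof -
    have "a < invf u x" "invf u x < b" using that u by (simp_all add: homeo_inv_less homeo_less_inv)
    then have "invf u x < f (invf u x)" using f by (simp add: bump_def pushes_def)
    then show ?thesis using u by (simp add: homeo_inv_less)
  qed
  ultimately show ?thesis using f u by (auto simp: bump_def pushes_def)
qed

definition zpow :: "(real \<Rightarrow> real) \<Rightarrow> int \<Rightarrow> real \<Rightarrow> real"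
  where "zpow f k = (if 0 \<le> k then f ^^ nat k else invf f ^^ nat (- k))"

context
  fixes f assumes f [simp]: "f \<in> carrier Homeo_plus"
begin

lemma homeo_zpow [simp]: "zpow f k \<in> carrier Homeo_plus"
  by (simp add: zpow_def)

lemma zpow_0 [simp]: "zpow f 0 = id"
  by (simp add: zpow_def id_def)

lemma zpow_Suc: "zpow f (k + 1) x = f (zpow f k x)"
proof (cases "0 \<le> k")
  case True
  then have "nat (k + 1) = Suc (nat k)" by simp
  with True show ?thesis by (simp add: zpow_def)
next
  case False
  then have "nat (- k) = Suc (nat (- (k + 1)))" by simp
  with False show ?thesis by (cases "k = -1") (auto simp: zpow_def)
qed

lemma zpow_commute: "zpow f k (f x) = f (zpow f k x)"
proof (induction k rule: int_induct[of _ 0])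
  case base
  show ?case by simp
next
  case (step1 i)
  then show ?case by (simp add: zpow_Suc)
next
  case (step2 i)
  then have "f (zpow f (i - 1) (f x)) = f (f (zpow f (i - 1) x))"
    using zpow_Suc[of "i - 1"] by simp
  then show ?case by simp
qed

lemma zpow_fixed: "f a = a \<Longrightarrow> zpow f k a = a"
proof (induction k rule: int_induct[of _ 0])
  case base
  show ?case by simp
next
  case (step1 i)
  then show ?case by (simp add: zpow_Suc)
next
  case (step2 i)
  then have "f (zpow f (i - 1) a) = f a"
    using zpow_Suc[of "i - 1"] by simp
  then show ?case by simp
qed

lemma inv_funpow_less: "(invf f ^^ n) x < y \<longleftrightarrow> x < (f ^^ n) y"
proof (induction n arbitrary: y)
  case (Suc n)
  have "(invf f ^^ Suc n) x < y \<longleftrightarrow> (invf f ^^ n) x < f y" by (simp add: homeo_inv_less)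
  also have "\<dots> \<longleftrightarrow> x < (f ^^ n) (f y)" by (rule Suc)
  finally show ?case by (simp add: funpow_swap1)
qed simp

end

text \<open>\<open>[0, 1)\<close> is mapped affinely onto the fundamental domain
  \<open>[x0, f x0)\<close>; equivariance forces all other values of the chart.\<close>

lemma pushes_chart:
  assumes "pushes a b f"
  shows "\<exists>E :: real \<Rightarrow> real. strict_mono E \<and> range E = {a<..<b} \<and> (\<forall>t. E (t + 1) = f (E t))"
proof -
  have f [simp]: "f \<in> carrier Homeo_plus" and ab: "a < b" and ends: "f a = a" "f b = b"
    and pos: "\<And>x. a < x \<Longrightarrow> x < b \<Longrightarrow> x < f x"
    using assms by (auto simp: pushes_def)
  define x0 where "x0 = (a + b) / 2"
  have x0: "a < x0" "x0 < b" using ab by (auto simp: x0_def)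
  have fx0: "x0 < f x0" "f x0 < b"
    using pos[OF x0] homeo_less[OF f, of x0 b] ends x0 by auto
  define X where "X k = zpow f k x0" for k
  have inside: "a < zpow f k x \<longleftrightarrow> a < x" "zpow f k x < b \<longleftrightarrow> x < b" for k x
    using homeo_less[OF homeo_zpow[OF f], of k a x] homeo_less[OF homeo_zpow[OF f], of k x b]
    by (simp_all add: zpow_fixed ends)
  have X: "a < X k" "X k < b" for k using x0 by (simp_all add: X_def inside)
  have XSuc: "X (k + 1) = f (X k)" for k by (simp add: X_def zpow_Suc)
  have X_mono: "X i \<le> X j" if "i \<le> j" for i j
    using that
  proof (induction j rule: int_ge_induct)
    case (step j)
    then show ?case using pos[of "X j"] X[of j] by (simp add: XSuc)
  qed simp
  define A where "A s = x0 + s * (f x0 - x0)" for s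
  have A: "x0 \<le> A s" "A s < f x0" if "0 \<le> s" "s < 1" for s
  proof -
    show "x0 \<le> A s" using that fx0 by (simp add: A_def)
    have "s * (f x0 - x0) < 1 * (f x0 - x0)" using that fx0 by (intro mult_strict_right_mono) auto
    then show "A s < f x0" by (simp add: A_def)
  qed
  define E where "E t = zpow f \<lfloor>t\<rfloor> (A (frac t))" for t
  have E_bounds: "X \<lfloor>t\<rfloor> \<le> E t" "E t < X (\<lfloor>t\<rfloor> + 1)" for t
    using A[of "frac t"] frac_ge_0[of t] frac_lt_1[of t]
    by (simp_all add: E_def X_def zpow_Suc[OF f] zpow_commute[OF f, symmetric])
  have "strict_mono E"
  proof (rule strict_monoI)
    fix t u :: real assume tu: "t < u"
    show "E t < E u"
    proof (cases "\<lfloor>t\<rfloor> = \<lfloor>u\<rfloor>")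
      case True
      then have "frac t < frac u" using tu by (simp add: frac_def)
      then show ?thesis using True fx0 by (simp add: E_def A_def)
    next
      case False
      then have "\<lfloor>t\<rfloor> + 1 \<le> \<lfloor>u\<rfloor>" using tu floor_mono[of t u] by linarith
      then show ?thesis using E_bounds[of t] E_bounds[of u] X_mono by fastforce
    qed
  qed
  moreover have "range E = {a<..<b}"
  proof (intro equalityI subsetI)
    fix y assume "y \<in> range E"
    then obtain t where "y = E t" by blast
    then show "y \<in> {a<..<b}" using E_bounds[of t] X[of "\<lfloor>t\<rfloor>"] X[of "\<lfloor>t\<rfloor> + 1"] by simp
  next
    fix y assume "y \<in> {a<..<b}"
    then have y: "a < y" "y < b" by auto
    obtain m where "y < (f ^^ m) x0"
      using homeo_dominated_orbit[OF f pos x0(1) y(2)] by blast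
    then have m: "y < X (int m)" by (simp add: X_def zpow_def)
    obtain n where "x0 < (f ^^ n) y"
      using homeo_dominated_orbit[OF f pos y(1) x0(2)] by blast
    then have "(invf f ^^ n) x0 < y" by (simp add: inv_funpow_less)
    then have n: "X (- int n) \<le> y" by (cases "n = 0") (auto simp: X_def zpow_def)
    \<comment> \<open>The index of the fundamental domain containing \<open>y\<close>. Without it,
      \<open>X k \<le> y\<close> would propagate from \<open>- int n\<close> upwards and reach
      \<open>int m\<close>.\<close>
    obtain k where k: "X k \<le> y" "y < X (k + 1)"
    proof (rule ccontr)
      assume "\<not> thesis"
      then have step: "X (k + 1) \<le> y" if "X k \<le> y" for k using \<open>\<And>k. X k \<le> y \<Longrightarrow> y < X (k + 1) \<Longrightarrow> thesis\<close> that by force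
      have "X k \<le> y" if "- int n \<le> k" for k
        using that by (induction k rule: int_ge_induct) (auto simp: n step)
      from this[of "int m"] m show False by simp
    qed
    define z where "z = invf (zpow f k) y"
    have z: "x0 \<le> z" "z < f x0" "zpow f k z = y"
      using k by (simp_all add: z_def homeo_le_inv homeo_inv_less X_def zpow_Suc zpow_commute)
    define s where "s = (z - x0) / (f x0 - x0)"
    have s: "0 \<le> s" "s < 1" "A s = z" using z fx0 by (auto simp: s_def A_def)
    have "\<lfloor>of_int k + s\<rfloor> = k" using s by linarith
    then have "E (of_int k + s) = y" using s z by (simp add: E_def frac_def)
    then show "y \<in> range E" by blast
  qed
  moreover have "E (t + 1) = f (E t)" for t
    by (simp add: E_def zpow_Suc frac_def)
  ultimately show ?thesis by blast
qed

text \<open>In suitable charts both maps are the translation by 1, and matching the charts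
  conjugates one into the other.\<close>

lemma pushes_conjugate:
  assumes f: "pushes a b f" and g: "pushes c d g"
  shows "\<exists>\<theta>\<in>carrier Homeo_plus. \<theta> a = c \<and> \<theta> b = d \<and>
    (\<forall>x. a \<le> x \<and> x \<le> b \<longrightarrow> \<theta> (f x) = g (\<theta> x)) \<and>
    (\<forall>x\<le>a. \<theta> x = x - a + c) \<and> (\<forall>x\<ge>b. \<theta> x = x - b + d)"
proof -
  obtain E :: "real \<Rightarrow> real" where E: "strict_mono E" "range E = {a<..<b}" "\<And>t. E (t + 1) = f (E t)"
    using pushes_chart[OF f] by blast
  obtain E' :: "real \<Rightarrow> real" where E': "strict_mono E'" "range E' = {c<..<d}" "\<And>t. E' (t + 1) = g (E' t)"
    using pushes_chart[OF g] by blast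
  obtain \<theta> where \<theta>: "\<theta> \<in> carrier Homeo_plus" "\<And>t. \<theta> (E t) = E' t"
    "\<forall>x\<le>a. \<theta> x = x - a + c" "\<forall>x\<ge>b. \<theta> x = x - b + d"
    using interval_homeo[OF E(1,2) E'(1,2)] by blast
  have mid: "\<theta> (f x) = g (\<theta> x)" if "a < x" "x < b" for x
  proof -
    have "x \<in> range E" unfolding E(2) using that by simp
    then obtain t where "x = E t" by blast
    then show ?thesis by (simp add: E(3)[symmetric] E'(3)[symmetric] \<theta>(2))
  qed
  have ends: "\<theta> a = c" "\<theta> b = d" using \<theta>(3,4) by auto
  have "\<theta> (f x) = g (\<theta> x)" if "a \<le> x" "x \<le> b" for x
  proof -
    consider "x = a" | "x = b" | "a < x" "x < b" using \<open>a \<le> x\<close> \<open>x \<le> b\<close> by linarith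
    then show ?thesis
    proof cases
      case 3
      then show ?thesis by (rule mid)
    qed (use f g ends in \<open>simp_all add: pushes_def\<close>)
  qed
  then show ?thesis using \<theta>(1,3,4) ends by (intro bexI[of _ \<theta>]) simp_all
qed

text \<open>Where \<open>\<phi>\<close> alters the value of \<open>s\<close>, that value lies in
  \<open>(d, s d)\<close>; so the point is left of \<open>d\<close> and is still sent beyond
  \<open>d\<close>. Hence \<open>\<phi> \<circ> s\<close> also moves all of \<open>(a, b)\<close> to
  the right and is conjugate to \<open>s\<close>.\<close>

lemma bump_perturb:
  assumes s: "bump a b s" and \<phi>: "\<phi> \<in> carrier Homeo_plus"
    and d: "a < d" "s d < b" and supp: "\<And>x. x \<le> d \<or> s d \<le> x \<Longrightarrow> \<phi> x = x"
  shows "\<exists>\<psi>\<in>carrier Homeo_plus. invf \<psi> \<circ> s \<circ> \<psi> = \<phi> \<circ> s \<and> (\<forall>x. x \<le> a \<or> b \<le> x \<longrightarrow> \<psi> x = x)"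
proof -
  have s': "s \<in> carrier Homeo_plus" "a < b" "\<And>x. x \<le> a \<or> b \<le> x \<Longrightarrow> s x = x"
    "\<And>x. a < x \<Longrightarrow> x < b \<Longrightarrow> x < s x"
    using s by (auto simp: bump_def pushes_def)
  have db: "d < b"
  proof (rule ccontr)
    assume "\<not> d < b"
    then have "s d = d" by (intro s'(3)) simp
    then show False using d \<open>\<not> d < b\<close> by simp
  qed
  have "x < \<phi> (s x)" if x: "a < x" "x < b" for x
  proof (cases "s x \<le> d \<or> s d \<le> s x")
    case True
    then show ?thesis using supp[of "s x"] s'(4)[OF x] by simp
  next
    case False
    then have "x < d" "d < s x" using s'(1) by auto
    moreover have "d < \<phi> (s x)" using homeo_less[OF \<phi>, of d "s x"] supp[of d] \<open>d < s x\<close> by simp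
    ultimately show ?thesis by simp
  qed
  moreover have out: "\<phi> (s x) = x" if "x \<le> a \<or> b \<le> x" for x
    using supp[of x] s'(3)[OF that] that d s'(4)[of d] db by fastforce
  ultimately have "pushes a b (\<phi> \<circ> s)"
    using s' \<phi> by (simp add: pushes_def)
  then obtain \<psi> where \<psi>: "\<psi> \<in> carrier Homeo_plus"
    "\<forall>x. a \<le> x \<and> x \<le> b \<longrightarrow> \<psi> ((\<phi> \<circ> s) x) = s (\<psi> x)"
    "\<forall>x\<le>a. \<psi> x = x - a + a" "\<forall>x\<ge>b. \<psi> x = x - b + b"
    using pushes_conjugate[of a b "\<phi> \<circ> s" a b s] s unfolding bump_def by blast
  have \<psi>_out: "\<psi> x = x" if "x \<le> a \<or> b \<le> x" for x using \<psi>(3,4) that by auto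
  have "invf \<psi> (s (\<psi> x)) = \<phi> (s x)" for x
  proof (cases "a \<le> x \<and> x \<le> b")
    case True
    then show ?thesis using \<psi>(2) homeo_inv_eq[OF \<psi>(1)] by simp
  next
    case False
    then have "x \<le> a \<or> b \<le> x" by auto
    then show ?thesis using \<psi>_out s'(3) out homeo_inv_eq[OF \<psi>(1)] by simp
  qed
  then show ?thesis using \<psi>(1) \<psi>_out by (intro bexI[of _ \<psi>]) (auto simp: fun_eq_iff)
qed

section \<open>The first two generators\<close>

text \<open>
  The generator of the chain with support \<open>(c, c + 18)\<close> is modelled on \<open>gen0\<close>. Since \<open>gen0\<close> acts by
  translations on \<open>[2, 5]\<close>, \<open>[6, 9]\<close> and \<open>[11, 13]\<close>, it carries \<open>(2, 4)\<close> to \<open>(6, 8)\<close>, and this to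
  \<open>9 + (2, 4)\<close>, and this to \<open>9 + (6, 8)\<close>, as translations. The orbit \<open>0 \<mapsto> 5 \<mapsto> 9\<close> under \<open>gen1\<close> and
  \<open>gen0\<close> ends exactly at the right endpoint of the support of \<open>gen1\<close>, which makes the supports
  of \<open>kth_bump\<close> below adjacent; the other values of \<open>gen1\<close> are chosen such that the support of
  \<open>base_bump\<close> is \<open>9 + (2, 4)\<close>.
\<close>

definition gen0 :: "real \<Rightarrow> real"
  where "gen0 x =
    (if x \<le> 0 then x else if x \<le> 2 then 3 * x else if x \<le> 5 then x + 4
     else if x \<le> 6 then 2 * x - 1 else if x \<le> 9 then x + 5 else if x \<le> 11 then x / 2 + 19 / 2
     else if x \<le> 13 then x + 4 else if x \<le> 18 then x / 5 + 72 / 5 else x)"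

definition gen1 :: "real \<Rightarrow> real"
  where "gen1 x =
    (if x \<le> -9 then x else if x \<le> 0 then 14 / 9 * x + 5 else if x \<le> 5 then x / 5 + 5
     else if x \<le> 7 then x + 1 else if x \<le> 9 then x / 2 + 9 / 2 else x)"

lemma homeo_gen0 [simp]: "gen0 \<in> carrier Homeo_plus"
  unfolding Homeo_plus_iff
proof
  show "strict_mono gen0"
    unfolding strict_mono_def gen0_def by auto
  let ?i = "\<lambda>y::real. if y \<le> 0 then y else if y \<le> 6 then y / 3 else if y \<le> 9 then y - 4
    else if y \<le> 11 then (y + 1) / 2 else if y \<le> 14 then y - 5 else if y \<le> 15 then 2 * y - 19
    else if y \<le> 17 then y - 4 else if y \<le> 18 then 5 * y - 72 else y"
  have "gen0 (?i y) = y" for y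
    unfolding gen0_def by (auto simp: field_simps)
  then show "surj gen0" by (rule surjI)
qed

lemma homeo_gen1 [simp]: "gen1 \<in> carrier Homeo_plus"
  unfolding Homeo_plus_iff
proof
  show "strict_mono gen1"
    unfolding strict_mono_def gen1_def by auto
  let ?i = "\<lambda>y::real. if y \<le> -9 then y else if y \<le> 5 then 9 / 14 * (y - 5) else if y \<le> 6 then 5 * (y - 5)
    else if y \<le> 8 then y - 1 else if y \<le> 9 then 2 * y - 9 else y"
  have "gen1 (?i y) = y" for y
    unfolding gen1_def by (auto simp: field_simps)
  then show "surj gen1" by (rule surjI)
qed

lemma bump_gen0: "bump 0 18 gen0"
  unfolding bump_def pushes_def by (simp, simp add: gen0_def)

lemma bump_gen1: "bump (-9) 9 gen1"
  unfolding bump_def pushes_def by (simp, simp add: gen1_def)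

lemma bump_le:
  assumes "bump a b f"
  shows "x \<le> f x"
  using assms unfolding bump_def pushes_def by (cases "a < x \<and> x < b") (auto simp: less_le not_less)

section \<open>A bump generated by \<open>gen0\<close> and \<open>gen1\<close>\<close>

definition comm_bump :: "real \<Rightarrow> real"
  where "comm_bump = invf gen1 \<circ> gen0 \<circ> gen1 \<circ> invf gen0"

text \<open>With \<open>x = gen0 y\<close>, moving \<open>x\<close> to the right means
  \<open>gen1 (gen0 y) < gen0 (gen1 y)\<close>. For \<open>0 < x \<le> 9\<close> the value 9
  separates the two sides, thanks to \<open>gen0 (gen1 0) = 9\<close> and \<open>gen1 9 = 9\<close>;
  for other \<open>x\<close> one of the generators fixes \<open>x\<close>.\<close>

lemma bump_comm_bump: "bump (invf gen1 0) 14 comm_bump"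
proof -
  have g: "x \<le> gen0 x" "x \<le> gen1 x" for x
    using bump_le bump_gen0 bump_gen1 by blast+
  have g0: "x \<le> 0 \<Longrightarrow> gen0 x = x" "0 < x \<Longrightarrow> x < 18 \<Longrightarrow> x < gen0 x" for x
    using bump_gen0 by (auto simp: bump_def pushes_def)
  have g1: "9 \<le> x \<Longrightarrow> gen1 x = x" "-9 < x \<Longrightarrow> x < 9 \<Longrightarrow> x < gen1 x" for x
    using bump_gen1 by (auto simp: bump_def pushes_def)
  have vals: "gen1 0 = 5" "gen0 5 = 9" "gen0 9 = 14" "gen1 9 = 9"
    by (simp_all add: gen0_def gen1_def)
  have i0: "invf gen0 x = x" if "x \<le> 0" for x using that g0 by (simp add: homeo_inv_eq)
  have i1: "invf gen1 x = x" if "9 \<le> x" for x using that g1 by (simp add: homeo_inv_eq)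
  have "comm_bump x = x" if "x \<le> invf gen1 0" for x
  proof -
    have "gen1 x \<le> 0" "x \<le> 0" using that g(2)[of x] by (auto simp: homeo_le_inv)
    then show ?thesis by (simp add: comm_bump_def i0 g0)
  qed
  moreover have "comm_bump x = x" if "14 \<le> x" for x
  proof -
    have "9 \<le> invf gen0 x" using that by (simp add: homeo_le_inv vals)
    then show ?thesis using that by (simp add: comm_bump_def g1 i1)
  qed
  moreover have "x < comm_bump x" if x: "invf gen1 0 < x" "x < 14" for x
  proof -
    define y where "y = invf gen0 x"
    have xy: "x = gen0 y" by (simp add: y_def)
    have pos: "0 < gen1 x" using x by (simp add: homeo_inv_less)
    have "gen1 x < gen0 (gen1 y)"
    proof (cases "x \<le> 0")
      case True
      then have "y = x" by (simp add: y_def i0)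
      moreover have "gen1 x < 18" using True homeo_le[OF homeo_gen1, of x 0] vals by simp
      ultimately show ?thesis using g0(2)[OF pos] by simp
    next
      case False
      then have y: "0 < y" by (simp add: y_def homeo_less_inv g0)
      then have "5 < gen1 y" using homeo_less[OF homeo_gen1, of 0 y] vals by simp
      then have *: "9 < gen0 (gen1 y)" using homeo_less[OF homeo_gen0, of 5 "gen1 y"] vals by simp
      show ?thesis
      proof (cases "x \<le> 9")
        case True
        then show ?thesis using * homeo_le[OF homeo_gen1, of x 9] vals by simp
      next
        case False
        have "y < 9" using x(2) by (simp add: y_def homeo_inv_less vals)
        then have "y < gen1 y" using y g1(2) by simp
        then show ?thesis using False g1(1)[of x] by (simp add: xy)
      qed
    qed
    then show ?thesis by (simp add: comm_bump_def y_def homeo_less_inv)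
  qed
  moreover have "invf gen1 0 < 14" by (simp add: homeo_inv_less gen1_def)
  ultimately show ?thesis by (auto simp: bump_def pushes_def comm_bump_def)
qed

text \<open>This word carries the support of \<open>comm_bump\<close> onto \<open>(11, 13)\<close>:
  the left end runs through 0, 5, 6 to 11, the right end 14 through 9, 5, 6, 7, 8 to 13.\<close>

definition base_shift :: "real \<Rightarrow> real"
  where "base_shift = gen0 \<circ> gen1 \<circ> gen1 \<circ> gen1 \<circ> invf gen0 \<circ> invf gen0"

definition base_bump :: "real \<Rightarrow> real"
  where "base_bump = base_shift \<circ> comm_bump \<circ> invf base_shift"

lemma homeo_base [simp]: "comm_bump \<in> carrier Homeo_plus" "base_shift \<in> carrier Homeo_plus"
    "base_bump \<in> carrier Homeo_plus"
  by (simp_all add: comm_bump_def base_shift_def base_bump_def)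

lemma base_shift_ends: "base_shift (invf gen1 0) = 11" "base_shift 14 = 13"
proof -
  have "0 \<le> gen1 0" by (simp add: gen1_def)
  then have "invf gen1 0 \<le> 0" by (simp add: homeo_inv_le)
  then have "gen0 (invf gen1 0) = invf gen1 0" by (simp add: gen0_def)
  then have "invf gen0 (invf gen1 0) = invf gen1 0" by (simp add: homeo_inv_eq)
  moreover have "gen0 (gen1 (gen1 0)) = 11" by (simp add: gen0_def gen1_def)
  ultimately show "base_shift (invf gen1 0) = 11" by (simp add: base_shift_def)
  have "invf gen0 (invf gen0 14) = 5" by (simp add: homeo_inv_eq gen0_def)
  moreover have "gen0 (gen1 (gen1 (gen1 5))) = 13" by (simp add: gen0_def gen1_def)
  ultimately show "base_shift 14 = 13" by (simp add: base_shift_def)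
qed

lemma bump_base_bump: "bump 11 13 base_bump"
  using bump_conj[OF bump_comm_bump homeo_base(2)] by (simp add: base_shift_ends base_bump_def)

section \<open>Compression into a fundamental domain\<close>

definition base_group :: "(real \<Rightarrow> real) set"
  where "base_group = carrier (subgroup_generated Homeo_plus {gen0, gen1})"

lemma base_group: "subgroup base_group Homeo_plus"
  and base_group_gens: "gen0 \<in> base_group" "gen1 \<in> base_group"
  using homeo_subgroup[of "{gen0, gen1}"] by (simp_all add: base_group_def)

lemma base_group_minimal:
  "subgroup C Homeo_plus \<Longrightarrow> gen0 \<in> C \<Longrightarrow> gen1 \<in> C \<Longrightarrow> base_group \<subseteq> C"
  unfolding base_group_def by (intro Homeo_plus.subgroup_generated_minimal) auto

lemma homeo_base_group: "f \<in> base_group \<Longrightarrow> f \<in> carrier Homeo_plus"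
  by (rule subgroup.mem_carrier[OF base_group])

lemma base_mem: "comm_bump \<in> base_group" "base_shift \<in> base_group" "base_bump \<in> base_group"
  unfolding base_bump_def comm_bump_def base_shift_def
  by (intro subgroup_rules base_group base_group_gens)+

text \<open>\<open>K\<close> moves all of \<open>(-9, 18)\<close> to the right, so a negative power
  of it brings \<open>z\<close> below 9, the end of the support of \<open>gen1\<close>. Powers of
  \<open>gen1\<close> then push \<open>y\<close> beyond \<open>invf comm_bump 9\<close> while
  \<open>z\<close> stays below 9. This is a fundamental domain of \<open>comm_bump\<close>, and
  \<open>base_shift\<close> carries it to one of \<open>base_bump\<close>.\<close>

lemma compress:
  assumes yz: "-9 < y" "z < 18"
  shows "\<exists>w\<in>base_group. \<exists>d. 11 < d \<and> base_bump d < 13 \<and> d < w y \<and> w z < base_bump d"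
proof -
  have g: "x \<le> gen0 x" "x \<le> gen1 x" for x
    using bump_le bump_gen0 bump_gen1 by blast+
  have g0: "0 < x \<Longrightarrow> x < 18 \<Longrightarrow> x < gen0 x" for x
    using bump_gen0 by (auto simp: bump_def pushes_def)
  have g1: "9 \<le> x \<Longrightarrow> gen1 x = x" "-9 < x \<Longrightarrow> x < 9 \<Longrightarrow> x < gen1 x" for x
    using bump_gen1 by (auto simp: bump_def pushes_def)
  define K where "K = gen0 \<circ> gen1"
  have K [simp]: "K \<in> carrier Homeo_plus" by (simp add: K_def)
  have Kpos: "x < K x" if "-9 < x" "x < 18" for x
    using that g(1)[of "gen1 x"] g1[of x] g0[of x] by (cases "x < 9") (auto simp: K_def)
  have "\<exists>N. z < (K ^^ N) (-1)"
    by (rule homeo_dominated_orbit[OF K Kpos]) (use yz in auto)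
  then obtain N where N: "z < (K ^^ N) (-1)" ..
  have KN: "(K ^^ N) (-9) = -9" by (induction N) (auto simp: K_def gen0_def gen1_def)
  have p: "bump (invf gen1 0) 14 comm_bump" by (rule bump_comm_bump)
  have i1: "invf gen1 0 < 9" by (simp add: homeo_inv_less gen1_def)
  have p9: "9 < comm_bump 9" using p i1 by (simp add: bump_def pushes_def)
  define y' z' where "y' = invf (K ^^ N) y" and "z' = invf (K ^^ N) z"
  have y': "-9 < y'" using yz by (simp add: y'_def homeo_less_inv KN)
  have "(K ^^ N) (-1) < (K ^^ N) 9" by simp
  with N have "z < (K ^^ N) 9" by (rule less_trans)
  then have z': "z' < 9" by (simp add: z'_def homeo_inv_less)
  have ip9: "invf comm_bump 9 < 9" using p9 by (simp add: homeo_inv_less)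
  obtain M where M: "invf comm_bump 9 < (gen1 ^^ M) y'"
    using homeo_dominated_orbit[OF homeo_gen1 g1(2) y' ip9] by auto
  have gM: "(gen1 ^^ M) 9 = 9" by (induction M) (auto simp: gen1_def)
  have zM: "(gen1 ^^ M) z' < 9" using homeo_less[of "gen1 ^^ M" z' 9] gM z' by simp
  define w where "w = base_shift \<circ> gen1 ^^ M \<circ> invf (K ^^ N)"
  define d where "d = base_shift (invf comm_bump 9)"
  have bd: "base_bump d = base_shift 9" by (simp add: d_def base_bump_def)
  have "w \<in> base_group"
    unfolding w_def K_def by (intro subgroup_rules base_mem base_group base_group_gens)
  moreover have "11 < d"
  proof -
    have "comm_bump (invf gen1 0) = invf gen1 0" using p by (simp add: bump_def)
    then have "invf gen1 0 < invf comm_bump 9" using i1 by (simp add: homeo_less_inv)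
    then have "base_shift (invf gen1 0) < d" by (simp add: d_def)
    then show ?thesis by (simp add: base_shift_ends)
  qed
  moreover have "base_bump d < 13"
    using homeo_less[OF homeo_base(2), of 9 14] by (simp add: bd base_shift_ends)
  moreover have "d < w y" using M by (simp add: d_def w_def y'_def)
  moreover have "w z < base_bump d" using zM by (simp add: bd w_def z'_def)
  ultimately show ?thesis by blast
qed

section \<open>Chains with prescribed elements\<close>

lemma supp_bump: "bump a b f \<Longrightarrow> homeo_supp f = {a<..<b}"
proof (intro equalityI subsetI)
  fix x assume f: "bump a b f"
  show "x \<in> {a<..<b}" if "x \<in> homeo_supp f"
    using f that by (auto simp: homeo_supp_def bump_def not_le[symmetric])
  show "x \<in> homeo_supp f" if "x \<in> {a<..<b}"
  proof -
    have "x < f x" using f that by (auto simp: bump_def pushes_def)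
    then show ?thesis by (simp add: homeo_supp_def)
  qed
qed

lemma left_endpoint_less: "a < c \<Longrightarrow> c < b \<Longrightarrow> left_endpoint {a<..<b} < left_endpoint {c<..<d}"
proof -
  assume *: "a < c" "c < b"
  have "left_endpoint {a<..<b} \<le> ereal ((a + c) / 2)"
    unfolding left_endpoint_def using * by (intro INF_lower) auto
  also have "\<dots> < ereal c" using * by simp
  also have "ereal c \<le> left_endpoint {c<..<d}"
    unfolding left_endpoint_def by (intro INF_greatest) auto
  finally show ?thesis .
qed

text \<open>For \<open>2 \<le> i\<close>, \<open>h i\<close> visits three blocks,
  \<open>c i + (2, 4)\<close>, \<open>c i + (6, 8)\<close> and \<open>c i + (11, 13)\<close>, and
  \<open>\<Psi> i\<close> acts on the middle one only. One step of \<open>h i\<close> from the first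
  block shows \<open>\<psi> i\<close>, two steps cancel it; comparing with \<open>h (i - 1)\<close>
  recovers \<open>\<phi> i\<close> when \<open>3 \<le> i\<close>.\<close>

lemma chain_contains:
  fixes m :: nat and \<phi> :: "nat \<Rightarrow> real \<Rightarrow> real"
  assumes m: "2 \<le> m" and yz: "-9 < y" "z < 18"
    and \<phi>: "\<And>i. i \<in> {3..m} \<Longrightarrow> \<phi> i \<in> carrier Homeo_plus"
    and supp: "\<And>i x. i \<in> {3..m} \<Longrightarrow> x \<le> y \<or> z \<le> x \<Longrightarrow> \<phi> i x = x"
  shows "\<exists>S \<subseteq> carrier Homeo_plus. chain_group m (subgroup_generated Homeo_plus S) \<and>
    base_group \<union> \<phi> ` {3..m} \<subseteq> carrier (subgroup_generated Homeo_plus S)"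
proof -
  let ?s = base_bump
  obtain w d where w_base: "w \<in> base_group"
    and d: "11 < d" "?s d < 13" "d < w y" "w z < ?s d"
    using compress[OF yz] by blast
  have w: "w \<in> carrier Homeo_plus" using w_base by (rule homeo_base_group)
  have s_out: "?s x = x" if "x \<le> 11 \<or> 13 \<le> x" for x
    using bump_base_bump that by (auto simp: bump_def)
  define \<phi>' where "\<phi>' i = w \<circ> \<phi> i \<circ> invf w" for i
  \<comment> \<open>The default \<open>id\<close> outside \<open>{3..m}\<close> makes
    \<open>h 2\<close> equal to \<open>gen0\<close>.\<close>
  have "\<exists>\<psi>\<in>carrier Homeo_plus. (i \<in> {3..m} \<longrightarrow> invf \<psi> \<circ> ?s \<circ> \<psi> = \<phi>' i \<circ> ?s) \<and>
      (\<forall>x. x \<le> 11 \<or> 13 \<le> x \<longrightarrow> \<psi> x = x) \<and> (i \<notin> {3..m} \<longrightarrow> \<psi> = id)" for i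
  proof (cases "i \<in> {3..m}")
    case True
    have "\<phi>' i x = x" if "x \<le> d \<or> ?s d \<le> x" for x
    proof -
      have "invf w x \<le> y \<or> z \<le> invf w x" using that d w by (auto simp: homeo_inv_le homeo_le_inv)
      then show ?thesis using supp[OF True] w by (simp add: \<phi>'_def)
    qed
    moreover have "\<phi>' i \<in> carrier Homeo_plus" using \<phi>[OF True] w by (simp add: \<phi>'_def)
    ultimately show ?thesis
      using bump_perturb[OF bump_base_bump, of "\<phi>' i" d] d True by auto
  next
    case False
    then show ?thesis by (intro bexI[of _ id]) auto
  qed
  then obtain \<psi> where \<psi> [simp]: "\<And>i. \<psi> i \<in> carrier Homeo_plus"
    and \<psi>_conj: "\<And>i. i \<in> {3..m} \<Longrightarrow> invf (\<psi> i) \<circ> ?s \<circ> \<psi> i = \<phi>' i \<circ> ?s"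
    and \<psi>_out: "\<And>i x. x \<le> 11 \<or> 13 \<le> x \<Longrightarrow> \<psi> i x = x"
    and \<psi>_id: "\<And>i. i \<notin> {3..m} \<Longrightarrow> \<psi> i = id"
    by metis
  have \<psi>_in: "11 \<le> \<psi> i x \<and> \<psi> i x \<le> 13" if "11 \<le> x" "x \<le> 13" for i x
    using that homeo_le[OF \<psi>, of i 11 x] homeo_le[OF \<psi>, of i x 13] \<psi>_out[of 11 i] \<psi>_out[of 13 i] by simp
  \<comment> \<open>The supports will be \<open>(c i, c i + 18)\<close>; \<open>c 1 = -9\<close> and
    \<open>c 2 = 0\<close> fit \<open>gen1\<close> and \<open>gen0\<close>.\<close>
  define c where "c i = 9 * (real i - 2)" for i
  have cS: "c (Suc i) = c i + 9" for i by (simp add: c_def)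
  \<comment> \<open>The shift by \<open>c i - 5\<close> brings \<open>[11, 13]\<close> to the middle
    block \<open>c i + [6, 8]\<close>.\<close>
  define \<Psi> where "\<Psi> i = (\<lambda>x. x + (c i - 5)) \<circ> \<psi> i \<circ> invf (\<lambda>x. x + (c i - 5))" for i
  define G where "G i = (\<lambda>x. x + c i) \<circ> gen0 \<circ> invf (\<lambda>x. x + c i)" for i
  define h where "h i = (if i = 1 then gen1 else \<Psi> i \<circ> G i \<circ> invf (\<Psi> i))" for i
  have \<Psi> [simp]: "\<Psi> i \<in> carrier Homeo_plus" for i
    unfolding \<Psi>_def by (intro homeo_comp homeo_inv homeo_translation \<psi>)
  have \<Psi>_apply: "\<Psi> i x = \<psi> i (x - (c i - 5)) + (c i - 5)" for i x
    by (simp add: \<Psi>_def)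
  have G_apply: "G i x = gen0 (x - c i) + c i" for i x
    by (simp add: G_def)
  have \<Psi>_out: "\<Psi> i (x + c i) = x + c i" "invf (\<Psi> i) (x + c i) = x + c i" if "x \<le> 6 \<or> 8 \<le> x" for i x
    using \<psi>_out[of "x + 5" i] that by (simp_all add: homeo_inv_eq \<Psi>_apply add.commute)
  have bump_h: "bump (c i) (c i + 18) (h i)" for i
  proof (cases "i = 1")
    case True
    then show ?thesis using bump_gen1 by (simp add: h_def c_def)
  next
    case False
    have "bump (c i) (c i + 18) (G i)"
      using bump_conj[OF bump_gen0 homeo_translation[of "c i"]] by (simp add: G_def add.commute)
    from bump_conj[OF this \<Psi>[of i]] show ?thesis
      using False \<Psi>_out(1)[of 0 i] \<Psi>_out(1)[of 18 i] by (simp add: h_def add.commute)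
  qed
  then have h [simp]: "h i \<in> carrier Homeo_plus" for i by (simp add: bump_def pushes_def)
  have h2: "h 2 = gen0"
    using \<psi>_id[of 2] by (auto simp: fun_eq_iff h_def c_def \<Psi>_apply G_apply homeo_inv_eq)
  \<comment> \<open>Away from the middle block \<open>h i\<close> follows the model. This gives its
    values on the last block and at the points 5 and 9 that the criterion for \<open>F\<close>
    needs.\<close>
  have h_out: "h i (x + c i) = gen0 x + c i"
    if "i \<noteq> 1" "x \<le> 6 \<or> 8 \<le> x" "gen0 x \<le> 6 \<or> 8 \<le> gen0 x" for i x
    using that \<Psi>_out by (simp add: h_def G_apply)
  have h_first: "h i (x + (c i - 9)) = \<psi> i x + (c i - 5)" if "i \<noteq> 1" "11 \<le> x" "x \<le> 13" for i x
  proof -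
    have "invf (\<Psi> i) (x + (c i - 9)) = x + (c i - 9)" using \<Psi>_out(2)[of "x - 9" i] that by (simp add: algebra_simps)
    moreover have "G i (x + (c i - 9)) = x + (c i - 5)"
      using that by (simp add: G_apply gen0_def)
    ultimately show ?thesis using that by (simp add: h_def \<Psi>_apply)
  qed
  have h_second: "h i (\<psi> i x + (c i - 5)) = x + c i" if "i \<noteq> 1" "11 \<le> x" "x \<le> 13" for i x
  proof -
    have "invf (\<Psi> i) (\<psi> i x + (c i - 5)) = x + (c i - 5)" by (simp add: homeo_inv_eq \<Psi>_apply)
    moreover have "G i (x + (c i - 5)) = x + c i" using that by (simp add: G_apply gen0_def)
    ultimately show ?thesis using that \<Psi>_out(1)[of x i] by (simp add: h_def)
  qed
  have h_third: "h i (x + c i) = x + (c i + 4)" if "i \<noteq> 1" "11 \<le> x" "x \<le> 13" for i x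
    using that h_out[of i x] by (simp add: gen0_def)

  define S where "S = h ` {1..m}"
  define C where "C = carrier (subgroup_generated Homeo_plus S)"
  have S: "S \<subseteq> carrier Homeo_plus" by (auto simp: S_def)
  have C: "subgroup C Homeo_plus" and SC: "S \<subseteq> C"
    using homeo_subgroup[OF S] by (simp_all add: C_def)
  have hC: "h i \<in> C" if "1 \<le> i" "i \<le> m" for i
    using SC that by (auto simp: S_def)
  have base: "base_group \<subseteq> C"
    using hC[of 1] hC[of 2] m h2 by (intro base_group_minimal C) (auto simp: h_def)
  \<comment> \<open>\<open>h i \<circ> h i\<close> translates \<open>c i + [2, 4]\<close> by 9, to
    the first block of the next support: \<open>\<psi> i\<close> enters at the first step and is
    undone at the second.\<close>
  have shifts: "\<exists>u\<in>C. \<forall>x. 11 \<le> x \<and> x \<le> 13 \<longrightarrow> u x = x + (c i - 9)" if "3 \<le> i" "i \<le> m" for i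
    using that
  proof (induction i rule: dec_induct)
    case base
    show ?case using subgroup.one_closed[OF C] by (intro bexI[of _ id]) (auto simp: c_def)
  next
    case (step i)
    then obtain u where u: "u \<in> C" "\<And>x. 11 \<le> x \<and> x \<le> 13 \<Longrightarrow> u x = x + (c i - 9)" by auto
    have "h i \<circ> h i \<circ> u \<in> C"
      using hC step.prems step.hyps u by (intro subgroup_comp C) auto
    moreover have "(h i \<circ> h i \<circ> u) x = x + (c (Suc i) - 9)" if "11 \<le> x \<and> x \<le> 13" for x
      using u(2)[OF that] h_first[of i x] h_second[of i x] that step.hyps by (simp add: cS)
    ultimately show ?case by blast
  qed
  have \<phi>C: "\<phi> i \<in> C" if i: "i \<in> {3..m}" for i
  proof -
    obtain u where u: "u \<in> C" "\<And>x. 11 \<le> x \<and> x \<le> 13 \<Longrightarrow> u x = x + (c i - 9)"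
      using shifts[of i] i by auto
    \<comment> \<open>The predecessor \<open>j\<close> is at least 2, so that \<open>h j\<close> is
      modelled on \<open>gen0\<close> and not on \<open>gen1\<close>.\<close>
    obtain j where j: "i = Suc j" "2 \<le> j" using i by (cases i) auto
    have uh: "u \<in> carrier Homeo_plus" using u(1) subgroup.mem_carrier[OF C] by simp
    \<comment> \<open>on \<open>[11, 13]\<close>, \<open>h j \<circ> u\<close> is a translation and \<open>h i \<circ> u\<close> the same translation after \<open>\<psi> i\<close>\<close>
    define v where "v = invf (h j \<circ> u) \<circ> (h i \<circ> u)"
    have vC: "v \<in> C" unfolding v_def
      using hC[of i] hC[of j] i j u by (intro subgroup_rules C) auto
    have v [simp]: "v \<in> carrier Homeo_plus" unfolding v_def using uh by simp
    have v_eq: "v x = \<psi> i x" if x: "11 \<le> x" "x \<le> 13" for x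
    proof -
      have "h i (u x) = \<psi> i x + (c i - 5)" using x u(2)[of x] h_first[of i x] j by simp
      moreover have "h j (u (\<psi> i x)) = \<psi> i x + (c i - 5)"
        using u(2)[of "\<psi> i x"] \<psi>_in[OF x, of i] h_third[of j "\<psi> i x"] j by (simp add: cS)
      ultimately show ?thesis using uh by (simp add: v_def homeo_inv_eq)
    qed
    \<comment> \<open>\<open>v\<close> and \<open>\<psi> i\<close> agree on \<open>[11, 13]\<close>,
      which contains the support of the bump, so they conjugate it to the same map.\<close>
    have "invf v x = invf (\<psi> i) x" if "?s x \<noteq> x" for x
    proof -
      have "11 \<le> x \<and> x \<le> 13" using s_out[of x] that by linarith
      then have "11 \<le> invf (\<psi> i) x" "invf (\<psi> i) x \<le> 13"
        using \<psi>_out[of 11 i] \<psi>_out[of 13 i] by (simp_all add: homeo_le_inv homeo_inv_le)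
      from v_eq[OF this] show ?thesis by (simp add: homeo_inv_eq)
    qed
    then have "invf v \<circ> ?s \<circ> v = invf (\<psi> i) \<circ> ?s \<circ> \<psi> i"
      using homeo_conj_cong[of "invf v" "invf (\<psi> i)" ?s] by simp
    then have "invf v \<circ> ?s \<circ> v = \<phi>' i \<circ> ?s" using \<psi>_conj[OF i] by simp
    then have "\<phi>' i = invf v \<circ> ?s \<circ> v \<circ> invf ?s" by (simp add: o_assoc[symmetric])
    then have "\<phi>' i \<in> C"
      using vC base_mem base C by (simp add: subgroup_rules subsetD)
    moreover have "w \<in> C" using w_base base by blast
    ultimately have "invf w \<circ> \<phi>' i \<circ> w \<in> C" using C by (intro subgroup_rules)
    moreover have "invf w \<circ> \<phi>' i \<circ> w = \<phi> i" using w by (simp add: \<phi>'_def fun_eq_iff)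
    ultimately show ?thesis by simp
  qed

  have supp_h: "homeo_supp (h i) = {c i<..<c i + 18}" for i by (rule supp_bump[OF bump_h])
  have "chain_of_intervals m (\<lambda>i. homeo_supp (h i))"
    unfolding chain_of_intervals_def supp_h
  proof (intro conjI ballI impI)
    fix i k assume "\<bar>int i - int k\<bar> > 1"
    then have "i + 2 \<le> k \<or> k + 2 \<le> i" by linarith
    then have "c i + 18 \<le> c k \<or> c k + 18 \<le> c i" by (auto simp: c_def)
    then show "{c i<..<c i + 18} \<inter> {c k<..<c k + 18} = {}" by auto
  next
    fix i
    have "c i + 12 \<in> {c i<..<c i + 18} \<inter> {c (i + 1)<..<c (i + 1) + 18}"
      "c i + 6 \<in> {c i<..<c i + 18} - {c (i + 1)<..<c (i + 1) + 18}"
      "c i + 20 \<in> {c (i + 1)<..<c (i + 1) + 18} - {c i<..<c i + 18}"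
      by (auto simp: cS)
    then show "{c i<..<c i + 18} \<inter> {c (i + 1)<..<c (i + 1) + 18} \<noteq> {}"
      "{c i<..<c i + 18} \<inter> {c (i + 1)<..<c (i + 1) + 18} \<subset> {c i<..<c i + 18}"
      "{c i<..<c i + 18} \<inter> {c (i + 1)<..<c (i + 1) + 18} \<subset> {c (i + 1)<..<c (i + 1) + 18}"
      by blast+
  qed (auto simp: is_interval_oo)
  moreover have "left_endpoint (homeo_supp (h i)) < left_endpoint (homeo_supp (h (i + 1)))" for i
    unfolding supp_h by (rule left_endpoint_less) (auto simp: cS)
  moreover have pos: "t \<le> h i t" for i t using bump_le[OF bump_h] .
  moreover have "subgroup_generated Homeo_plus {h i, h (i + 1)} \<cong> thompson_F" if "1 \<le> i" for i
  proof (rule chain_pair_iso_thompson[where b = "c (i + 1)" and c = "c i + 18"])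
    show "h i t = t" if "c i + 18 \<le> t" for t using bump_h[of i] that by (simp add: bump_def)
    show "h (i + 1) t = t" if "t \<le> c (i + 1)" for t using bump_h[of "i + 1"] that by (simp add: bump_def)
    show "c (i + 1) < c i + 18" by (simp add: cS)
    show "c i + 18 < h (i + 1) (c i + 18)"
      using bump_h[of "i + 1"] by (simp add: bump_def pushes_def cS)
    \<comment> \<open>From \<open>c (i + 1) = c i + 9\<close> the orbit goes to
      \<open>c i + 14\<close> and on to \<open>c i + 18\<close>: the orbit 0, 5, 9 of the model,
      which meets the required inequality with equality.\<close>
    have "h i (9 + c i) = 14 + c i"
    proof (cases "i = 1")
      case True
      then show ?thesis by (simp add: h_def c_def gen1_def)
    next
      case False
      then show ?thesis using h_out[of i 9] by (simp add: gen0_def)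
    qed
    moreover have "h (i + 1) (5 + c (i + 1)) = 9 + c (i + 1)"
      using h_out[of "i + 1" 5] that by (simp add: gen0_def)
    ultimately show "c i + 18 \<le> h (i + 1) (h i (c (i + 1)))"
      by (simp add: cS add.commute)
  qed (simp_all add: pos)
  ultimately have "chain_group m (subgroup_generated Homeo_plus S)"
    using m unfolding chain_group_def S_def by (intro conjI exI[of _ h]) auto
  then show ?thesis
    using S base \<phi>C unfolding C_def by (intro exI[of _ S]) auto
qed

section \<open>Homeomorphisms whose support has finitely many components\<close>

lemma finite_frontier_connected:
  fixes S :: "real set"
  assumes "connected S" shows "finite (frontier S)"
proof -
  have "\<exists>a b. S = {} \<or> S = UNIV \<or> S = {..<b} \<or> S = {..b} \<or> S = {a<..} \<or> S = {a..} \<or>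
      S = {a<..<b} \<or> S = {a<..b} \<or> S = {a..<b} \<or> S = {a..b}"
    using connectedD_interval[OF assms] by (intro interval_cases) blast
  then obtain a b where "S = {} \<or> S = UNIV \<or> S = {..<b} \<or> S = {..b} \<or> S = {a<..} \<or> S = {a..} \<or>
      S = {a<..<b} \<or> S = {a<..b} \<or> S = {a..<b} \<or> S = {a..b}" by blast
  moreover have "closure {a<..<b} \<subseteq> {a..b}" "closure {a<..b} \<subseteq> {a..b}" "closure {a..<b} \<subseteq> {a..b}"
    by (rule closure_minimal; auto)+
  then have "frontier {a<..<b} \<subseteq> {a, b}" "frontier {a..b} \<subseteq> {a, b}" "frontier {a<..b} \<subseteq> {a, b}"
      "frontier {a..<b} \<subseteq> {a, b}"
    by (fastforce simp: frontier_def)+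
  then have "finite (frontier {a<..<b})" "finite (frontier {a..b})" "finite (frontier {a<..b})"
      "finite (frontier {a..<b})"
    by (blast intro: finite_subset)+
  moreover have "frontier {..<b} \<subseteq> {b}" "frontier {..b} \<subseteq> {b}" "frontier {a<..} \<subseteq> {a}" "frontier {a..} \<subseteq> {a}"
    by (auto simp: frontier_def interior_open)
  then have "finite (frontier {..<b})" "finite (frontier {..b})" "finite (frontier {a<..})"
      "finite (frontier {a..})"
    by (blast intro: finite_subset)+
  ultimately show ?thesis
    by (elim disjE) simp_all
qed

lemma finite_frontier:
  fixes U :: "real set"
  assumes "finite (components U)" shows "finite (frontier U)"
proof -
  have "frontier (\<Union>(components U)) \<subseteq> (\<Union>t\<in>components U. frontier t)"
    using assms by (rule frontier_Union_subset)
  moreover have "finite (\<Union>t\<in>components U. frontier t)"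
    using assms finite_frontier_connected in_components_connected by blast
  ultimately show ?thesis using finite_subset by (metis Union_components)
qed

lemma open_homeo_supp: "f \<in> carrier Homeo_plus \<Longrightarrow> open (homeo_supp f)"
  unfolding homeo_supp_def by (intro open_Collect_neq homeo_continuous continuous_on_id)

lemma homeo_frontier_supp: "f \<in> carrier Homeo_plus \<Longrightarrow> t \<in> frontier (homeo_supp f) \<Longrightarrow> f t = t"
  using open_homeo_supp[of f] by (auto simp: frontier_def interior_open homeo_supp_def)

text \<open>A connected set that misses the frontier lies inside or outside the support. Inside it
  \<open>f x - x\<close> has no zero, so its sign cannot change.\<close>

lemma homeo_constant_sign:
  assumes f: "f \<in> carrier Homeo_plus" and S: "connected S" "S \<inter> frontier (homeo_supp f) = {}"
  shows "(\<forall>x\<in>S. x < f x) \<or> (\<forall>x\<in>S. f x < x) \<or> (\<forall>x\<in>S. f x = x)"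
proof (rule ccontr)
  assume not: "\<not> ?thesis"
  have "S \<inter> homeo_supp f = {} \<or> S \<subseteq> homeo_supp f"
    using connected_Int_frontier[OF S(1), of "homeo_supp f"] S(2) by blast
  with not have moved: "S \<subseteq> homeo_supp f" by (auto simp: homeo_supp_def)
  from not obtain x y where "x \<in> S" "\<not> x < f x" "y \<in> S" "\<not> f y < y" by blast
  moreover from this moved have "f x \<noteq> x" "f y \<noteq> y" by (auto simp: homeo_supp_def)
  ultimately have xy: "x \<in> S" "f x < x" "y \<in> S" "y < f y" by auto
  have "connected ((\<lambda>x. f x - x) ` S)"
    by (intro connected_continuous_image continuous_intros homeo_continuous f S)
  then have "0 \<in> (\<lambda>x. f x - x) ` S"
    by (rule connectedD_interval[of _ "f x - x" "f y - y"]) (use xy in auto)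
  then show False using moved by (auto simp: homeo_supp_def)
qed

section \<open>A row of adjacent bumps\<close>

definition next_bump :: "real \<Rightarrow> real"
  where "next_bump = gen0 \<circ> gen0 \<circ> gen1 \<circ> gen1"

definition bump_end :: "nat \<Rightarrow> real"
  where "bump_end k = (next_bump ^^ k) (invf gen1 0)"

definition kth_bump :: "nat \<Rightarrow> real \<Rightarrow> real"
  where "kth_bump k = next_bump ^^ k \<circ> comm_bump \<circ> invf (next_bump ^^ k)"

lemma homeo_next_bump [simp]: "next_bump \<in> carrier Homeo_plus"
  by (simp add: next_bump_def)

lemma bump_kth_bump: "bump (bump_end k) (bump_end (Suc k)) (kth_bump k)"
proof -
  \<comment> \<open>The left end of the support of \<open>comm_bump\<close> runs through 0, 5, 9 to
    the right end 14, which makes consecutive supports adjacent.\<close>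
  have "next_bump (invf gen1 0) = 14"
    by (simp add: next_bump_def) (simp add: gen0_def gen1_def)
  then have "(next_bump ^^ k) 14 = bump_end (Suc k)"
    by (simp add: bump_end_def funpow_swap1)
  then show ?thesis
    using bump_conj[OF bump_comm_bump homeo_funpow[OF homeo_next_bump], of k]
    by (simp add: kth_bump_def bump_end_def)
qed

lemma kth_bump_mem: "kth_bump k \<in> base_group"
  unfolding kth_bump_def next_bump_def
  by (intro subgroup_rules base_mem base_group base_group_gens)

text \<open>All ends stay below 18, a common fixed point of the generators; so the row remains in
  the region that \<open>compress\<close> can handle.\<close>

lemma bump_end_bounds: "-9 < bump_end 0" "bump_end k < 18"
proof -
  show "-9 < bump_end 0" by (simp add: bump_end_def homeo_less_inv gen1_def)
  have "gen0 18 = 18" "gen1 18 = 18" by (simp_all add: gen0_def gen1_def)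
  then have "next_bump 18 = 18" by (simp add: next_bump_def)
  then have "(next_bump ^^ k) 18 = 18" by (induction k) simp_all
  moreover have "invf gen1 0 < 18" by (simp add: homeo_inv_less gen1_def)
  ultimately show "bump_end k < 18"
    using homeo_less[OF homeo_funpow[OF homeo_next_bump], of k "invf gen1 0" 18]
    by (simp add: bump_end_def)
qed

section \<open>Conjugation into the group of the first two generators\<close>

lemma homeo_affine: "0 < m \<Longrightarrow> (\<lambda>x. m * x + c) \<in> carrier Homeo_plus"
  unfolding Homeo_plus_iff
  by (auto simp: strict_mono_def intro!: surjI[of _ "\<lambda>y. (y - c) / m"])

text \<open>A map that moves \<open>(a, b)\<close> in one direction is conjugate to
  \<open>kth_bump k\<close> or to its inverse. For the identity, \<open>\<theta>\<close> just has to
  match the ends, and an affine map does.\<close>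

lemma conj_to_kth_bump:
  assumes f: "f \<in> carrier Homeo_plus" and ab: "a < b" "f a = a" "f b = b"
    and sign: "(\<forall>x\<in>{a<..<b}. x < f x) \<or> (\<forall>x\<in>{a<..<b}. f x < x) \<or> (\<forall>x\<in>{a<..<b}. f x = x)"
  shows "\<exists>\<theta>\<in>carrier Homeo_plus. \<exists>r\<in>base_group. \<theta> a = bump_end k \<and> \<theta> b = bump_end (Suc k) \<and>
    (\<forall>x. a \<le> x \<and> x \<le> b \<longrightarrow> \<theta> (f x) = r (\<theta> x)) \<and>
    (\<forall>y. y \<le> bump_end k \<or> bump_end (Suc k) \<le> y \<longrightarrow> r y = y)"
proof -
  let ?p = "kth_bump k" and ?c = "bump_end k" and ?d = "bump_end (Suc k)"
  have p: "?p \<in> carrier Homeo_plus" "?c < ?d" "\<And>y. y \<le> ?c \<or> ?d \<le> y \<Longrightarrow> ?p y = y" "pushes ?c ?d ?p"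
    using bump_kth_bump[of k] by (auto simp: bump_def pushes_def)
  from sign consider "pushes a b f" | "\<forall>x\<in>{a<..<b}. f x < x" | "\<forall>x\<in>{a<..<b}. f x = x"
    using f ab by (auto simp: pushes_def)
  then show ?thesis
  proof cases
    case 1
    then show ?thesis
      using pushes_conjugate[OF 1 p(4)] p(3) kth_bump_mem by meson
  next
    case 2
    have "pushes a b (invf f)"
      using 2 f ab by (simp add: pushes_def homeo_inv_eq homeo_less_inv)
    then obtain \<theta> where \<theta>: "\<theta> \<in> carrier Homeo_plus" "\<theta> a = ?c" "\<theta> b = ?d"
      "\<And>x. a \<le> x \<and> x \<le> b \<Longrightarrow> \<theta> (invf f x) = ?p (\<theta> x)"
      using pushes_conjugate[OF _ p(4)] by meson
    have "\<theta> (f x) = invf ?p (\<theta> x)" if "a \<le> x \<and> x \<le> b" for x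
    proof -
      have "a \<le> f x \<and> f x \<le> b" using that homeo_le[OF f, of a x] homeo_le[OF f, of x b] ab by simp
      from \<theta>(4)[OF this] show ?thesis using f p(1) by (simp add: eq_commute[of "\<theta> (f x)"] homeo_inv_eq)
    qed
    moreover have "invf ?p y = y" if "y \<le> ?c \<or> ?d \<le> y" for y
      using p(3)[OF that] p(1) by (simp add: homeo_inv_eq)
    moreover have "invf ?p \<in> base_group"
      by (intro subgroup_rules base_group kth_bump_mem)
    ultimately show ?thesis using \<theta>(1-3) by blast
  next
    case 3
    define m where "m = (?d - ?c) / (b - a)"
    have m: "0 < m" "m * (b - a) = ?d - ?c" using ab p(2) by (simp_all add: m_def)
    have "f x = x" if "a \<le> x \<and> x \<le> b" for x
      using that 3 ab by (cases "x = a \<or> x = b") auto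
    moreover have "m * a + (?c - m * a) = ?c" "m * b + (?c - m * a) = ?d"
      using m(2) by (simp_all add: algebra_simps)
    moreover have "id \<in> base_group" using subgroup.one_closed[OF base_group] by simp
    ultimately show ?thesis
      using homeo_affine[OF m(1), of "?c - m * a"]
      by (intro bexI[of _ "\<lambda>x. m * x + (?c - m * a)"] bexI[of _ id]) simp_all
  qed
qed

text \<open>Cut at the last point \<open>b'\<close> of \<open>insert a T\<close> before
  \<open>b\<close>, and induct on the number of such points. The left part goes to the first
  \<open>k\<close> intervals of the row, the right part to the next one; the two elements found have
  disjoint supports, so their product serves on both sides.\<close>

lemma conj_to_base_group:
  assumes f: "f \<in> carrier Homeo_plus" and T: "finite T" "\<And>t. t \<in> T \<Longrightarrow> f t = t" and fa: "f a = a"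
    and "a \<le> b" "f b = b"
    and sign: "\<And>u v. a \<le> u \<Longrightarrow> u < v \<Longrightarrow> v \<le> b \<Longrightarrow> {u<..<v} \<inter> T = {} \<Longrightarrow>
      (\<forall>x\<in>{u<..<v}. x < f x) \<or> (\<forall>x\<in>{u<..<v}. f x < x) \<or> (\<forall>x\<in>{u<..<v}. f x = x)"
  shows "\<exists>\<theta>\<in>carrier Homeo_plus. \<exists>q\<in>base_group. \<exists>k. \<theta> a = bump_end 0 \<and> \<theta> b = bump_end k \<and>
    (\<forall>x. a \<le> x \<and> x \<le> b \<longrightarrow> \<theta> (f x) = q (\<theta> x)) \<and>
    (\<forall>y. y \<le> bump_end 0 \<or> bump_end k \<le> y \<longrightarrow> q y = y)"
  using assms(5-7)
proof (induction "card (insert a T \<inter> {a..<b})" arbitrary: b rule: less_induct)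
  case less
  show ?case
  proof (cases "a = b")
    case True
    have "id \<in> base_group" using subgroup.one_closed[OF base_group] by simp
    then show ?thesis
      using True fa homeo_translation[of "bump_end 0 - a"]
      by (intro bexI[of _ "\<lambda>x. x + (bump_end 0 - a)"] bexI[of _ id] exI[of _ 0]) auto
  next
    case False
    then have "a < b" using less.prems by simp
    \<comment> \<open>Including \<open>a\<close> guarantees a cut point.\<close>
    let ?A = "insert a T \<inter> {a..<b}"
    have A: "finite ?A" "a \<in> ?A" using T(1) \<open>a < b\<close> by auto
    define b' where "b' = Max ?A"
    have b'A: "b' \<in> ?A" unfolding b'_def using A by (intro Max_in) auto
    have b'_max: "t \<le> b'" if "t \<in> ?A" for t unfolding b'_def using A(1) that by (rule Max_ge)
    have b': "a \<le> b'" "b' < b" "f b' = b'" using b'A T fa by auto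
    have "insert a T \<inter> {a..<b'} \<subset> ?A" using b'A b' by auto
    then have "card (insert a T \<inter> {a..<b'}) < card ?A" using A(1) by (rule psubset_card_mono[rotated])
    from less.hyps[OF this b'(1,3)] less.prems(3) b'(2)
    obtain \<theta> q k where \<theta>: "\<theta> \<in> carrier Homeo_plus" "\<theta> a = bump_end 0" "\<theta> b' = bump_end k"
      and q: "q \<in> base_group" "\<And>y. y \<le> bump_end 0 \<or> bump_end k \<le> y \<Longrightarrow> q y = y"
      and conj: "\<And>x. a \<le> x \<and> x \<le> b' \<Longrightarrow> \<theta> (f x) = q (\<theta> x)"
      by (smt (verit))
    have "{b'<..<b} \<inter> T = {}" using b'_max b'(1) by force
    note sgn = less.prems(3)[OF b'(1,2) order_refl this]
    obtain \<theta>' r where \<theta>': "\<theta>' \<in> carrier Homeo_plus" "\<theta>' b' = bump_end k" "\<theta>' b = bump_end (Suc k)"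
      and r: "r \<in> base_group" "\<And>y. y \<le> bump_end k \<or> bump_end (Suc k) \<le> y \<Longrightarrow> r y = y"
      and conj': "\<And>x. b' \<le> x \<and> x \<le> b \<Longrightarrow> \<theta>' (f x) = r (\<theta>' x)"
      using conj_to_kth_bump[OF f b'(2,3) less.prems(2) sgn, of k] by meson
    have rh: "r \<in> carrier Homeo_plus" by (rule homeo_base_group[OF r(1)])
    define \<Theta> where "\<Theta> x = (if x \<le> b' then \<theta> x else \<theta>' x)" for x
    have \<Theta>: "\<Theta> \<in> carrier Homeo_plus"
      unfolding \<Theta>_def using \<theta> \<theta>' by (intro homeo_glue) auto
    have ends: "\<Theta> a = bump_end 0" "\<Theta> b = bump_end (Suc k)"
      using b' \<theta> \<theta>' by (auto simp: \<Theta>_def)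
    have le: "bump_end 0 \<le> bump_end k" "bump_end k \<le> bump_end (Suc k)"
      using homeo_le[OF \<theta>(1), of a b'] homeo_le[OF \<theta>'(1), of b' b] \<theta> \<theta>' b' by auto
    have "\<Theta> (f x) = (q \<circ> r) (\<Theta> x)" if x: "a \<le> x \<and> x \<le> b" for x
    proof (cases "x \<le> b'")
      case True
      have "f x \<le> b'" using True homeo_le[OF f, of x b'] b' by simp
      moreover have "\<theta> x \<le> bump_end k" using True homeo_le[OF \<theta>(1), of x b'] \<theta> by simp
      ultimately show ?thesis using True x conj[of x] r(2)[of "\<theta> x"] by (simp add: \<Theta>_def)
    next
      case False
      have "\<not> f x \<le> b'" using False homeo_le[OF f, of x b'] b' by simp
      moreover have "bump_end k \<le> \<theta>' x" using False homeo_le[OF \<theta>'(1), of b' x] \<theta>' by simp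
      then have "bump_end k \<le> r (\<theta>' x)"
        using homeo_le[OF rh, of "bump_end k" "\<theta>' x"] r(2)[of "bump_end k"] by simp
      ultimately show ?thesis using False x conj'[of x] q(2)[of "r (\<theta>' x)"] by (simp add: \<Theta>_def)
    qed
    moreover have "(q \<circ> r) y = y" if "y \<le> bump_end 0 \<or> bump_end (Suc k) \<le> y" for y
    proof -
      have "r y = y" using that le by (intro r(2)) auto
      moreover have "q y = y" using that le by (intro q(2)) auto
      ultimately show ?thesis by simp
    qed
    moreover have "q \<circ> r \<in> base_group" using q r by (intro subgroup_rules base_group)
    ultimately show ?thesis using \<Theta> ends by blast
  qed
qed

text \<open>Transplanting to \<open>(0, 1)\<close> first makes unbounded components bounded and
  leaves finitely many cut points. Composing the chart with the conjugator then moves the transplant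
  into \<open>base_group\<close>.\<close>

lemma transplant_to_base_group:
  assumes f: "f \<in> carrier Homeo_plus" and fin: "finite (components (homeo_supp f))"
  shows "\<exists>(E :: real \<Rightarrow> real) a b. strict_mono E \<and> range E = {a<..<b} \<and> -9 < a \<and> b < 18 \<and>
    transplant E f \<in> base_group"
proof -
  obtain E :: "real \<Rightarrow> real" where E: "strict_mono E" "range E = {0<..<1}"
    using unit_interval_chart by blast
  let ?F = "transplant E f"
  have F: "?F \<in> carrier Homeo_plus" using homeo_transplant[OF E f] .
  have FE: "?F (E t) = E (f t)" for t using E(1) by (rule transplant_apply)
  define T where "T = E ` frontier (homeo_supp f)"
  have T: "finite T" "\<And>t. t \<in> T \<Longrightarrow> ?F t = t"
    using finite_frontier[OF fin] homeo_frontier_supp[OF f] by (auto simp: T_def FE)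
  have F01: "?F 0 = 0" "?F 1 = 1" by (simp_all add: transplant_outside E(2))
  have "(\<forall>x\<in>{u<..<v}. x < ?F x) \<or> (\<forall>x\<in>{u<..<v}. ?F x < x) \<or> (\<forall>x\<in>{u<..<v}. ?F x = x)"
    if uv: "0 \<le> u" "u < v" "v \<le> 1" "{u<..<v} \<inter> T = {}" for u v
  proof -
    \<comment> \<open>The points that \<open>E\<close> sends into \<open>(u, v)\<close> form an
      interval free of frontier points, so the sign of \<open>f\<close> is constant on it.\<close>
    define I where "I = {t. u < E t \<and> E t < v}"
    have "is_interval I"
      unfolding is_interval_1 I_def using E(1)
      by (auto dest: strict_mono_less_eq[THEN iffD2] intro: less_le_trans le_less_trans)
    then have "connected I" by (simp add: is_interval_connected_1)
    moreover have "I \<inter> frontier (homeo_supp f) = {}" using uv(4) by (auto simp: I_def T_def)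
    ultimately have "(\<forall>t\<in>I. t < f t) \<or> (\<forall>t\<in>I. f t < t) \<or> (\<forall>t\<in>I. f t = t)"
      by (rule homeo_constant_sign[OF f])
    moreover have "\<forall>x\<in>{u<..<v}. P x (?F x)" if "\<forall>t\<in>I. P (E t) (E (f t))" for P
    proof
      fix x assume x: "x \<in> {u<..<v}"
      then have "x \<in> range E" using E(2) uv by simp
      then obtain t where t: "x = E t" by blast
      with x have "t \<in> I" by (simp add: I_def)
      then show "P x (?F x)" using that by (simp add: t FE)
    qed
    note this[of "(<)"] this[of "\<lambda>x y. y < x"] this[of "\<lambda>x y. y = x"]
    ultimately show ?thesis
      using E(1) by (simp only: strict_mono_less strict_mono_eq) blast
  qed
  from conj_to_base_group[OF F T F01(1) _ F01(2) this]
  obtain \<theta> q k where \<theta>: "\<theta> \<in> carrier Homeo_plus" "\<theta> 0 = bump_end 0" "\<theta> 1 = bump_end k"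
    and q: "q \<in> base_group" "\<And>y. y \<le> bump_end 0 \<or> bump_end k \<le> y \<Longrightarrow> q y = y"
    and conj: "\<And>x. 0 \<le> x \<and> x \<le> 1 \<Longrightarrow> \<theta> (?F x) = q (\<theta> x)"
    by (smt (verit))
  have mono: "strict_mono (\<theta> \<circ> E)" using E(1) \<theta>(1) by (simp add: strict_mono_def)
  have "\<theta> ` {0<..<1} = {bump_end 0<..<bump_end k}"
  proof (intro equalityI subsetI)
    fix y assume "y \<in> \<theta> ` {0<..<1}"
    then show "y \<in> {bump_end 0<..<bump_end k}" using \<theta> by (auto simp: \<theta>(2,3)[symmetric])
  next
    fix y assume "y \<in> {bump_end 0<..<bump_end k}"
    then have "invf \<theta> y \<in> {0<..<1}" using \<theta> by (simp add: homeo_inv_less homeo_less_inv)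
    then show "y \<in> \<theta> ` {0<..<1}" using \<theta>(1) by (intro image_eqI[of _ _ "invf \<theta> y"]) simp_all
  qed
  then have range: "range (\<theta> \<circ> E) = {bump_end 0<..<bump_end k}" by (metis E(2) image_comp)
  have "transplant (\<theta> \<circ> E) f = q"
  proof (rule transplant_eqI[OF mono])
    fix t
    have "0 < E t \<and> E t < 1" using E(2) by (metis greaterThanLessThan_iff rangeI)
    then show "q ((\<theta> \<circ> E) t) = (\<theta> \<circ> E) (f t)" using conj[of "E t"] by (simp add: FE)
  next
    fix x assume "x \<notin> range (\<theta> \<circ> E)"
    then show "q x = x" unfolding range by (intro q(2)) auto
  qed
  then show ?thesis using mono range bump_end_bounds q(1) by metis
qed

section \<open>Embedding into chain groups\<close>

text \<open>As \<open>transplant E\<close> is an injective homomorphism, its image needs to be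
  located for the generators only.\<close>

lemma transplant_mon:
  assumes E: "strict_mono E" "range E = {a<..<b}" and R: "R \<subseteq> carrier Homeo_plus"
    and S: "S \<subseteq> carrier Homeo_plus"
    and sub: "transplant E ` R \<subseteq> carrier (subgroup_generated Homeo_plus S)" (is "_ \<subseteq> ?C")
  shows "transplant E \<in> mon (subgroup_generated Homeo_plus R) (subgroup_generated Homeo_plus S)"
proof -
  have C: "subgroup ?C Homeo_plus" using S by (rule homeo_generated_subgroup)
  interpret group_hom Homeo_plus Homeo_plus "transplant E"
    by unfold_locales (auto simp: hom_def homeo_transplant[OF E] transplant_comp[OF E(1)])
  have "transplant E g \<in> ?C" if "g \<in> carrier (subgroup_generated Homeo_plus R)" for g
  proof -
    have "g \<in> generate Homeo_plus R"
      using that R by (simp add: carrier_subgroup_generated Int_absorb1)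
    then show ?thesis
    proof induction
      case one
      show ?case using subgroup.one_closed[OF C] by (simp only: hom_one)
    next
      case (incl g)
      then show ?case using sub by blast
    next
      case (inv g)
      then have "invf (transplant E g) \<in> ?C" using sub C by (intro subgroup.m_inv_closed) auto
      then show ?case using hom_inv[of g] R inv by auto
    next
      case (eng g h)
      then show ?case
        using subgroup_comp[OF C] by (simp only: mult_Homeo_plus transplant_comp[OF E(1)])
    qed
  qed
  moreover have "carrier (subgroup_generated Homeo_plus R) \<subseteq> carrier Homeo_plus"
    by (rule Homeo_plus.carrier_subgroup_generated_subset)
  ultimately show ?thesis
    using inj_on_subset[OF inj_transplant[OF E(1)]] transplant_comp[OF E(1)]
    by (auto simp: mon_def hom_def)
qed

text \<open>The chain group contains \<open>base_group\<close> in any case, so indices from 3 on are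
  spent only on generators whose transplants lie elsewhere.\<close>

lemma embeds_in_chain_group:
  fixes E :: "real \<Rightarrow> real" and f :: "nat \<Rightarrow> real \<Rightarrow> real"
  assumes E: "strict_mono E" "range E = {a<..<b}" "-9 < a" "b < 18" and m: "2 \<le> m"
    and R: "R \<subseteq> carrier Homeo_plus" and f: "\<And>i. i \<in> {3..m} \<Longrightarrow> f i \<in> carrier Homeo_plus"
    and R_cases: "\<And>g. g \<in> R \<Longrightarrow> transplant E g \<in> base_group \<or> g \<in> f ` {3..m}"
  shows "\<exists>H. chain_group m H \<and> mon (subgroup_generated Homeo_plus R) H \<noteq> {}"
proof -
  have "transplant E (f i) \<in> carrier Homeo_plus" if "i \<in> {3..m}" for i
    using homeo_transplant[OF E(1,2) f[OF that]] .
  moreover have "transplant E (f i) x = x" if "x \<le> a \<or> b \<le> x" for i x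
    using that by (intro transplant_outside) (auto simp: E(2))
  ultimately obtain S where S: "S \<subseteq> carrier Homeo_plus" "chain_group m (subgroup_generated Homeo_plus S)"
    "base_group \<union> (\<lambda>i. transplant E (f i)) ` {3..m} \<subseteq> carrier (subgroup_generated Homeo_plus S)"
    using chain_contains[OF m E(3,4), of "\<lambda>i. transplant E (f i)"] by blast
  have "transplant E ` R \<subseteq> carrier (subgroup_generated Homeo_plus S)"
    using R_cases S(3) by blast
  from transplant_mon[OF E(1,2) R S(1) this] S(2) show ?thesis by blast
qed

theorem theorem1p4:
  fixes n :: nat and f :: "nat \<Rightarrow> real \<Rightarrow> real"
  assumes "n \<ge> 2"
    and "\<forall>i\<in>{1..n}. f i \<in> carrier Homeo_plus"
  shows "(\<exists>H. chain_group (n + 2) H \<and>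
            mon (subgroup_generated Homeo_plus (f ` {1..n})) H \<noteq> {}) \<and>
         (finite (components (homeo_supp (f 1))) \<longrightarrow>
           (\<exists>H. chain_group (n + 1) H \<and>
             mon (subgroup_generated Homeo_plus (f ` {1..n})) H \<noteq> {}))"
proof (intro conjI impI)
  have R: "f ` {1..n} \<subseteq> carrier Homeo_plus" using assms(2) by auto
  obtain E :: "real \<Rightarrow> real" where E: "strict_mono E" "range E = {0<..<1}"
    using unit_interval_chart by blast
  \<comment> \<open>Indices 1 and 2 of the chain belong to \<open>gen1\<close> and
    \<open>gen0\<close>, hence the shift by 2.\<close>
  have "f ` {1..n} \<subseteq> (\<lambda>i. f (i - 2)) ` {3..n + 2}"
  proof (rule image_subsetI)
    fix i assume "i \<in> {1..n}"
    then show "f i \<in> (\<lambda>i. f (i - 2)) ` {3..n + 2}" by (intro image_eqI[of _ _ "i + 2"]) auto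
  qed
  moreover have "f (i - 2) \<in> carrier Homeo_plus" if "i \<in> {3..n + 2}" for i
    by (rule bspec[OF assms(2)]) (use that in auto)
  ultimately show "\<exists>H. chain_group (n + 2) H \<and> mon (subgroup_generated Homeo_plus (f ` {1..n})) H \<noteq> {}"
    by (intro embeds_in_chain_group[OF E _ _ _ R, of "n + 2" "\<lambda>i. f (i - 2)"]) auto
  assume "finite (components (homeo_supp (f 1)))"
  then obtain E :: "real \<Rightarrow> real" and a b where E: "strict_mono E" "range E = {a<..<b}" "-9 < a" "b < 18"
    "transplant E (f 1) \<in> base_group"
    using transplant_to_base_group[of "f 1"] assms by auto
  \<comment> \<open>\<open>f 1\<close> is already accounted for by \<open>base_group\<close>;
    \<open>f 2\<close> to \<open>f n\<close> take the indices 3 to \<open>n + 1\<close>.\<close>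
  have R_cases: "transplant E g \<in> base_group \<or> g \<in> (\<lambda>i. f (i - 1)) ` {3..n + 1}" if "g \<in> f ` {1..n}" for g
  proof -
    from that obtain i where i: "i \<in> {1..n}" "g = f i" by blast
    show ?thesis
    proof (cases "i = 1")
      case True
      then show ?thesis using E(5) i by simp
    next
      case False
      then have "g \<in> (\<lambda>i. f (i - 1)) ` {3..n + 1}" using i by (intro image_eqI[of _ _ "i + 1"]) auto
      then show ?thesis ..
    qed
  qed
  have "f (i - 1) \<in> carrier Homeo_plus" if "i \<in> {3..n + 1}" for i
    by (rule bspec[OF assms(2)]) (use that in auto)
  from embeds_in_chain_group[OF E(1-4) _ R this R_cases] assms(1)
  show "\<exists>H. chain_group (n + 1) H \<and> mon (subgroup_generated Homeo_plus (f ` {1..n})) H \<noteq> {}"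
    by simp
qed

end
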